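(* Let $p\in(0,1)$ and let $(\sigma^{(n),p})_{n\ge 1}$ be the sequence of random recursive separable permutations of parameter $p$. Then there is a random permuton $\boldsymbol{\mu}$, defined on the same probability space as the process $(\sigma^{(n),p})_{n\ge1}$, such that almost surely $\sigma^{(n),p}$ converges to $\boldsymbol{\mu}$ in the sense of permutons as $n\to\infty$, i.e. almost surely the measures $\mu_{\sigma^{(n),p}}$ converge weakly to $\boldsymbol{\mu}$. (This limit is called the recursive separable permuton of parameter $p$.)
   Context: Recursive separable permutations: $\sigma^{(1),p}$ is the unique permutation of size $1$. Given $\sigma^{(n),p}$ (a permutation of size $n$), the permutation $\sigma^{(n+1),p}$ of size $n+1$ is obtained as follows, using randomness independent of the past: (1) take $j$ uniformly at random in $\{1,\dots,n\}$; (2) in the one-line notation of $\sigma^{(n),p}$, increase all values bigger than $j$ by $1$; (3) with probability $p$ replace the entry $j$ by the two consecutive entries $j,\,j+1$, and with probability $1-p$ replace it by $j+1,\,j$. A permuton is a Borel probability measure on $[0,1]^2$ whose two one-dimensional marginals are the Lebesgue measure on $[0,1]$. To a permutation $\pi$ of size $n$ one associates the permuton $\mu_\pi=\frac1n\sum_{i=1}^n\lambda(i,\pi(i))$, where $\lambda(i,\pi(i))$ is the uniform probability measure on the square $[\frac{i-1}{n},\frac in]\times[\frac{\pi(i)-1}{n},\frac{\pi(i)}{n}]$. A sequence of permutations $\pi^{(n)}$ converges to a permuton $\mu$ if $\mu_{\pi^{(n)}}\to\mu$ weakly. A random permuton is a random variable with values in the space of permutons equipped with the weak topology. *)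

theory Defs
  imports "HOL-Probability.Probability"
begin

text \<open>Permutations of size \<open>n\<close> are given by their one-line notation, a list of length \<open>n\<close> with
  entries \<open>1, \<dots>, n\<close>. In \<open>grow j b w\<close> the flag \<open>b\<close> selects the increasing replacement of \<open>j\<close>.\<close>

definition grow :: "nat \<Rightarrow> bool \<Rightarrow> nat list \<Rightarrow> nat list" where
  "grow j b w =
     concat (map (\<lambda>v. if v < j then [v]
                      else if v = j then (if b then [j, j + 1] else [j + 1, j])
                      else [v + 1]) w)"

text \<open>The pair \<open>(J n, B n)\<close> is the randomness of the step from size \<open>n\<close> to size \<open>n + 1\<close>:
  \<open>J n\<close> is uniform on \<open>{1..n}\<close>, \<open>B n\<close> is Bernoulli of parameter \<open>p\<close> and independent of \<open>J n\<close>, and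
  the pairs for different \<open>n\<close> are independent. The value \<open>\<sigma> 0\<close> is irrelevant.\<close>

definition recursive_separable_process ::
    "'a measure \<Rightarrow> real \<Rightarrow> (nat \<Rightarrow> 'a \<Rightarrow> nat list) \<Rightarrow> bool" where
  "recursive_separable_process M p \<sigma> \<longleftrightarrow>
     (\<forall>n\<ge>1. \<sigma> n \<in> M \<rightarrow>\<^sub>M count_space UNIV) \<and>
     (AE \<omega> in M. \<sigma> 1 \<omega> = [1]) \<and>
     (\<exists>(J :: nat \<Rightarrow> 'a \<Rightarrow> nat) (B :: nat \<Rightarrow> 'a \<Rightarrow> bool).
        prob_space.indep_vars M (\<lambda>_. count_space UNIV) (\<lambda>n \<omega>. (J n \<omega>, B n \<omega>)) {1..} \<and>
        (\<forall>n\<ge>1. distr M (count_space UNIV) (\<lambda>\<omega>. (J n \<omega>, B n \<omega>)) =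
                 measure_pmf (pair_pmf (pmf_of_set {1..n}) (bernoulli_pmf p))) \<and>
        (\<forall>n\<ge>1. AE \<omega> in M. \<sigma> (n + 1) \<omega> = grow (J n \<omega>) (B n \<omega>) (\<sigma> n \<omega>)))"

abbreviation unit_square :: "(real \<times> real) set" where
  "unit_square \<equiv> {0..1} \<times> {0..1}"

definition permutons :: "(real \<times> real) measure set" where
  "permutons = {\<mu>. prob_space \<mu> \<and> sets \<mu> = sets (restrict_space borel unit_square) \<and>
     distr \<mu> (restrict_space borel {0..1}) fst = restrict_space lborel {0..1} \<and>
     distr \<mu> (restrict_space borel {0..1}) snd = restrict_space lborel {0..1}}"

text \<open>Continuous functions on the unit square are bounded by compactness, so the test functions
  below are all the bounded continuous functions.\<close>

definition weak_topology :: "(real \<times> real) measure topology" where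
  "weak_topology = topology_generated_by
     {{\<mu> \<in> permutons. (\<integral>x. f x \<partial>\<mu>) \<in> U} | (f :: real \<times> real \<Rightarrow> real) U.
        continuous_on unit_square f \<and> open U}"

definition borel_permutons :: "(real \<times> real) measure measure" where
  "borel_permutons = sigma permutons {U. openin weak_topology U}"

definition cell :: "nat \<Rightarrow> nat \<Rightarrow> nat \<Rightarrow> (real \<times> real) set" where
  "cell n i k = {(real i - 1) / real n..real i / real n} \<times> {(real k - 1) / real n..real k / real n}"

text \<open>List positions start at \<open>0\<close>, so \<open>w ! (i - 1)\<close> is the \<open>i\<close>-th entry of \<open>w\<close>.\<close>

definition permuton_of :: "nat list \<Rightarrow> (real \<times> real) measure" where
  "permuton_of w = (let n = length w in
     measure_of unit_square (sets (restrict_space borel unit_square))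
       (\<lambda>A. (\<Sum>i=1..n. emeasure (uniform_measure lborel (cell n i (w ! (i - 1)))) A) / of_nat n))"

end

theory Submission
  imports Defs
begin

text \<open>For a permutation \<open>w\<close> of size \<open>n\<close> and a function \<open>f\<close> on the unit square let \<open>A f w\<close> be the
average of \<open>f\<close> over the points \<open>(i/n, w(i)/n)\<close>. For Lipschitz \<open>f\<close> it differs from the integral
of \<open>f\<close> against the permuton of \<open>w\<close> by \<open>O(1/n)\<close> (\<open>integral_permuton_of\<close>), so weak
convergence is a question about the averages \<open>A f (\<sigma> n)\<close> for polynomials \<open>f\<close>.

One growth step from size \<open>n\<close> to \<open>n + 1\<close> moves the coordinate \<open>i/n\<close> to \<open>i/(n+1)\<close> or to
\<open>(i+1)/(n+1)\<close>, depending on whether the split position lies at or after \<open>i\<close>, or before it. The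
split position is uniform, so the probability of the second case is \<open>(i-1)/n\<close>, and the mean
displacement is only \<open>-1/(n(n+1))\<close>; the same holds for the second coordinate, as the split value
is uniform too. The duplicated point contributes on average what is needed for the larger number
of points. Taylor expansion to second order therefore shows that \<open>A f\<close> changes by \<open>O(1/n)\<close> in
each step (\<open>grow_step_bound\<close>), but by \<open>O(1/n\<^sup>2)\<close> in conditional mean (\<open>grow_step_drift\<close>), for
either value of the flag that orders the two new entries. So \<open>A f (\<sigma> n)\<close> is a martingale up to
a summable error, with increments that are square summable. Only orthogonality is then needed:
\<open>E (A f (\<sigma> m) - A f (\<sigma> n))\<^sup>2 \<le> C (m - n) / n\<^sup>2\<close> for \<open>n \<le> m\<close> (\<open>second_moment\<close>). Along the cubes
\<open>n = k\<^sup>3\<close> the increments have summable first moments, and between two consecutive cubes the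
averages vary by \<open>O(1/k)\<close>; hence they converge almost surely (\<open>AE_convergent\<close>).

Countably many polynomials, those with rational coefficients, are dense in the continuous functions,
so almost surely all their averages converge at once. A limit permuton exists because the set of
permutons is sequentially compact (\<open>permutons_sequentially_compact\<close>). This compactness is reduced
to Helly's theorem on the line: a measurable injection of the square into a bounded interval, given by
interleaving binary digits, has an inverse that extends to a continuous map of the line onto
the square. The pushed-forward measures have a weak limit point on the line, and its image under this
continuous map is a limit in the square; its marginals are uniform since their characteristic
functions are limits of a constant sequence, that of the uniform law.

The same countable family of polynomials gives a countable base of the weak topology, so the limit
depends measurably on the sample point (\<open>measurable_borel_permutonsI\<close>).\<close>

section \<open>Test functions with a second-order expansion\<close>

text \<open>A quantitative form of being twice differentiable on the square. It is stated through the remainder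
of the first-order expansion, with \<open>gx\<close> and \<open>gy\<close> in the role of the partial derivatives,
because in this form it is closed under products by pure algebra. The bound on \<open>f\<close>
itself is included for the product rule.\<close>

definition second_order_bound :: "(real \<times> real \<Rightarrow> real) \<Rightarrow> (real \<times> real \<Rightarrow> real) \<Rightarrow> (real \<times> real \<Rightarrow> real) \<Rightarrow> real \<Rightarrow> bool" where
  "second_order_bound f gx gy C \<longleftrightarrow> (\<forall>u\<in>unit_square. \<forall>v\<in>unit_square.
     \<bar>f u\<bar> \<le> C \<and> \<bar>gx u\<bar> \<le> C \<and> \<bar>gy u\<bar> \<le> C \<and>
     \<bar>f v - f u - gx u * (fst v - fst u) - gy u * (snd v - snd u)\<bar>
       \<le> C * ((fst v - fst u)\<^sup>2 + (snd v - snd u)\<^sup>2))"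

definition second_order :: "(real \<times> real \<Rightarrow> real) \<Rightarrow> bool" where
  "second_order f \<longleftrightarrow> (\<exists>gx gy C. second_order_bound f gx gy C)"

lemma second_order_bound_nonneg:
  assumes "second_order_bound f gx gy C" shows "0 \<le> C"
proof -
  have "(0,0) \<in> unit_square" by simp
  then have "\<bar>f (0,0)\<bar> \<le> C" using assms unfolding second_order_bound_def by blast
  then show ?thesis by linarith
qed

lemma second_order_boundD:
  assumes "second_order_bound f gx gy C" "u \<in> unit_square"
  shows "\<bar>f u\<bar> \<le> C" "\<bar>gx u\<bar> \<le> C" "\<bar>gy u\<bar> \<le> C"
  using assms unfolding second_order_bound_def by blast+

lemma second_order_bound_remainder:
  assumes "second_order_bound f gx gy C" "u \<in> unit_square" "v \<in> unit_square"
  shows "\<bar>f v - f u - gx u * (fst v - fst u) - gy u * (snd v - snd u)\<bar>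
       \<le> C * ((fst v - fst u)\<^sup>2 + (snd v - snd u)\<^sup>2)"
  using assms unfolding second_order_bound_def by blast

text \<open>The quadratic remainder is at most linear because coordinates in the square differ by at most \<open>1\<close>.\<close>

lemma second_order_bound_lipschitz:
  assumes "second_order_bound f gx gy C" "u \<in> unit_square" "v \<in> unit_square"
  shows "\<bar>f v - f u\<bar> \<le> 2 * C * (\<bar>fst v - fst u\<bar> + \<bar>snd v - snd u\<bar>)"
proof -
  define a b where "a = fst v - fst u" and "b = snd v - snd u"
  have ab: "\<bar>a\<bar> \<le> 1" "\<bar>b\<bar> \<le> 1" using assms(2,3) by (auto simp: a_def b_def mem_Times_iff)
  have C: "0 \<le> C" by (rule second_order_bound_nonneg[OF assms(1)])
  have h: "\<bar>gx u\<bar> \<le> C" "\<bar>gy u\<bar> \<le> C" "\<bar>f v - f u - gx u * a - gy u * b\<bar> \<le> C * (a\<^sup>2 + b\<^sup>2)"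
    using assms unfolding second_order_bound_def a_def b_def by blast+
  have "\<bar>gx u * a\<bar> \<le> C * \<bar>a\<bar>" "\<bar>gy u * b\<bar> \<le> C * \<bar>b\<bar>"
    using h by (auto simp: abs_mult intro!: mult_right_mono)
  moreover have "a\<^sup>2 \<le> \<bar>a\<bar>" "b\<^sup>2 \<le> \<bar>b\<bar>"
    using ab mult_left_mono[OF ab(1), of "\<bar>a\<bar>"] mult_left_mono[OF ab(2), of "\<bar>b\<bar>"]
    by (auto simp: power2_eq_square simp flip: abs_mult)
  then have "C * (a\<^sup>2 + b\<^sup>2) \<le> C * (\<bar>a\<bar> + \<bar>b\<bar>)" using C by (intro mult_left_mono) auto
  moreover have "C * (\<bar>a\<bar> + \<bar>b\<bar>) = C * \<bar>a\<bar> + C * \<bar>b\<bar>"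
    "2 * C * (\<bar>a\<bar> + \<bar>b\<bar>) = 2 * (C * \<bar>a\<bar>) + 2 * (C * \<bar>b\<bar>)" by (simp_all add: algebra_simps)
  ultimately show ?thesis using h(3) unfolding a_def[symmetric] b_def[symmetric] by linarith
qed

lemma second_order_affine: "second_order (\<lambda>z. a * fst z + b * snd z + c)"
proof -
  have "second_order_bound (\<lambda>z. a * fst z + b * snd z + c) (\<lambda>_. a) (\<lambda>_. b) (\<bar>a\<bar> + \<bar>b\<bar> + \<bar>c\<bar>)"
    unfolding second_order_bound_def
  proof (intro ballI conjI)
    fix u v :: "real \<times> real" assume u: "u \<in> unit_square"
    then have "\<bar>fst u\<bar> \<le> 1" "\<bar>snd u\<bar> \<le> 1" by (simp_all add: mem_Times_iff)
    then have "\<bar>a * fst u\<bar> \<le> \<bar>a\<bar>" "\<bar>b * snd u\<bar> \<le> \<bar>b\<bar>"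
      by (simp_all add: abs_mult mult_left_le)
    then show "\<bar>a * fst u + b * snd u + c\<bar> \<le> \<bar>a\<bar> + \<bar>b\<bar> + \<bar>c\<bar>" by linarith
    have "a * fst v + b * snd v + c - (a * fst u + b * snd u + c) - a * (fst v - fst u) - b * (snd v - snd u) = 0"
      by (simp add: algebra_simps)
    then show "\<bar>a * fst v + b * snd v + c - (a * fst u + b * snd u + c) - a * (fst v - fst u) - b * (snd v - snd u)\<bar>
      \<le> (\<bar>a\<bar> + \<bar>b\<bar> + \<bar>c\<bar>) * ((fst v - fst u)\<^sup>2 + (snd v - snd u)\<^sup>2)"
      by (simp only: abs_zero) (intro mult_nonneg_nonneg add_nonneg_nonneg; simp)
  qed linarith+
  then show ?thesis by (auto simp: second_order_def)
qed

lemma second_order_add: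
  assumes "second_order f" "second_order g" shows "second_order (\<lambda>z. f z + g z)"
proof -
  obtain fx fy C where f: "second_order_bound f fx fy C" using assms(1) by (auto simp: second_order_def)
  obtain gx gy D where g: "second_order_bound g gx gy D" using assms(2) by (auto simp: second_order_def)
  have "second_order_bound (\<lambda>z. f z + g z) (\<lambda>z. fx z + gx z) (\<lambda>z. fy z + gy z) (C + D)"
    unfolding second_order_bound_def
  proof (intro ballI)
    fix u v :: "real \<times> real" assume uv: "u \<in> unit_square" "v \<in> unit_square"
    define a b where "a = fst v - fst u" and "b = snd v - snd u"
    have 1: "\<bar>f u\<bar> \<le> C" "\<bar>fx u\<bar> \<le> C" "\<bar>fy u\<bar> \<le> C" "\<bar>f v - f u - fx u * a - fy u * b\<bar> \<le> C * (a\<^sup>2 + b\<^sup>2)"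
      using f uv unfolding second_order_bound_def a_def b_def by blast+
    have 2: "\<bar>g u\<bar> \<le> D" "\<bar>gx u\<bar> \<le> D" "\<bar>gy u\<bar> \<le> D" "\<bar>g v - g u - gx u * a - gy u * b\<bar> \<le> D * (a\<^sup>2 + b\<^sup>2)"
      using g uv unfolding second_order_bound_def a_def b_def by blast+
    have 3: "\<bar>f v + g v - (f u + g u) - (fx u + gx u) * a - (fy u + gy u) * b\<bar> \<le> (C + D) * (a\<^sup>2 + b\<^sup>2)"
      using 1(4) 2(4) unfolding distrib_right by linarith
    have 4: "\<bar>f u + g u\<bar> \<le> C + D" "\<bar>fx u + gx u\<bar> \<le> C + D" "\<bar>fy u + gy u\<bar> \<le> C + D"
      using 1(1-3) 2(1-3) by linarith+
    show "\<bar>f u + g u\<bar> \<le> C + D \<and> \<bar>fx u + gx u\<bar> \<le> C + D \<and> \<bar>fy u + gy u\<bar> \<le> C + D \<and>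
       \<bar>f v + g v - (f u + g u) - (fx u + gx u) * (fst v - fst u) - (fy u + gy u) * (snd v - snd u)\<bar>
       \<le> (C + D) * ((fst v - fst u)\<^sup>2 + (snd v - snd u)\<^sup>2)"
      using 3 4 unfolding a_def b_def by blast
  qed
  then show ?thesis by (auto simp: second_order_def)
qed

text \<open>With \<open>\<Delta>f = f v - f u\<close> and likewise \<open>\<Delta>g\<close>, the product expands as
\<open>f v * g v - f u * g u = f u * \<Delta>g + g u * \<Delta>f + \<Delta>f * \<Delta>g\<close>.
The first two terms give the product rule and a remainder of at most \<open>2 C D\<close> times the squared
distance; the last is second order by the Lipschitz bounds and contributes another \<open>8 C D\<close>.\<close>

lemma second_order_mult:
  assumes "second_order f" "second_order g" shows "second_order (\<lambda>z. f z * g z)"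
proof -
  obtain fx fy C where f: "second_order_bound f fx fy C" using assms(1) by (auto simp: second_order_def)
  obtain gx gy D where g: "second_order_bound g gx gy D" using assms(2) by (auto simp: second_order_def)
  have CD: "0 \<le> C" "0 \<le> D" using f g second_order_bound_nonneg by auto
  have "second_order_bound (\<lambda>z. f z * g z) (\<lambda>z. f z * gx z + g z * fx z) (\<lambda>z. f z * gy z + g z * fy z) (10 * (C * D))"
    unfolding second_order_bound_def
  proof (intro ballI)
    fix u v :: "real \<times> real" assume uv: "u \<in> unit_square" "v \<in> unit_square"
    define a b where "a = fst v - fst u" and "b = snd v - snd u"
    define s where "s = a\<^sup>2 + b\<^sup>2"
    define R where "R = f v - f u - fx u * a - fy u * b"
    define S where "S = g v - g u - gx u * a - gy u * b"
    have 1: "\<bar>f u\<bar> \<le> C" "\<bar>fx u\<bar> \<le> C" "\<bar>fy u\<bar> \<le> C" "\<bar>R\<bar> \<le> C * s"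
      using f uv unfolding second_order_bound_def a_def b_def s_def R_def by blast+
    have 2: "\<bar>g u\<bar> \<le> D" "\<bar>gx u\<bar> \<le> D" "\<bar>gy u\<bar> \<le> D" "\<bar>S\<bar> \<le> D * s"
      using g uv unfolding second_order_bound_def a_def b_def s_def S_def by blast+
    have lf: "\<bar>f v - f u\<bar> \<le> 2 * C * (\<bar>a\<bar> + \<bar>b\<bar>)" and lg: "\<bar>g v - g u\<bar> \<le> 2 * D * (\<bar>a\<bar> + \<bar>b\<bar>)"
      using second_order_bound_lipschitz[OF f uv] second_order_bound_lipschitz[OF g uv] by (auto simp: a_def b_def)
    have "\<bar>(f v - f u) * (g v - g u)\<bar> \<le> (2 * C * (\<bar>a\<bar> + \<bar>b\<bar>)) * (2 * D * (\<bar>a\<bar> + \<bar>b\<bar>))"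
      unfolding abs_mult using CD by (intro mult_mono lf lg) auto
    also have "\<dots> = 4 * (C * D) * (\<bar>a\<bar> + \<bar>b\<bar>)\<^sup>2" by (simp add: power2_eq_square)
    also have "\<dots> \<le> 4 * (C * D) * (2 * s)"
    proof (intro mult_left_mono)
      have "0 \<le> (\<bar>a\<bar> - \<bar>b\<bar>)\<^sup>2" by simp
      then show "(\<bar>a\<bar> + \<bar>b\<bar>)\<^sup>2 \<le> 2 * s" unfolding s_def by (simp add: power2_sum power2_diff)
    qed (use CD in auto)
    finally have P: "\<bar>(f v - f u) * (g v - g u)\<bar> \<le> 8 * (C * D * s)" by simp
    have Q: "\<bar>f u * S\<bar> \<le> C * (D * s)" "\<bar>g u * R\<bar> \<le> D * (C * s)"
      unfolding abs_mult using CD 1 2 by (auto intro!: mult_mono)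
    have eq: "f v * g v - f u * g u - (f u * gx u + g u * fx u) * a - (f u * gy u + g u * fy u) * b
       = f u * S + g u * R + (f v - f u) * (g v - g u)"
      unfolding R_def S_def by (simp add: algebra_simps)
    have main: "\<bar>f v * g v - f u * g u - (f u * gx u + g u * fx u) * a - (f u * gy u + g u * fy u) * b\<bar>
        \<le> 10 * (C * D) * s"
      unfolding eq using P Q by (simp add: algebra_simps)
    have m: "\<bar>f u * g u\<bar> \<le> C * D" "\<bar>f u * gx u\<bar> \<le> C * D" "\<bar>g u * fx u\<bar> \<le> D * C"
      "\<bar>f u * gy u\<bar> \<le> C * D" "\<bar>g u * fy u\<bar> \<le> D * C"
      unfolding abs_mult using CD 1 2 by (auto intro!: mult_mono)
    have cd0: "0 \<le> C * D" using CD by simp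
    have "\<bar>f u * g u\<bar> \<le> 10 * (C * D)" "\<bar>f u * gx u + g u * fx u\<bar> \<le> 10 * (C * D)"
      "\<bar>f u * gy u + g u * fy u\<bar> \<le> 10 * (C * D)"
      using m cd0 by (auto simp: mult.commute[of D C])
    then show "\<bar>f u * g u\<bar> \<le> 10 * (C * D) \<and> \<bar>f u * gx u + g u * fx u\<bar> \<le> 10 * (C * D) \<and> \<bar>f u * gy u + g u * fy u\<bar> \<le> 10 * (C * D) \<and>
       \<bar>f v * g v - f u * g u - (f u * gx u + g u * fx u) * (fst v - fst u) - (f u * gy u + g u * fy u) * (snd v - snd u)\<bar>
       \<le> 10 * (C * D) * ((fst v - fst u)\<^sup>2 + (snd v - snd u)\<^sup>2)"
      using main unfolding a_def b_def s_def by blast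
  qed
  then show ?thesis by (auto simp: second_order_def)
qed

section \<open>Polynomials with rational coefficients\<close>

text \<open>Expressions rather than functions, so that countability is that of a datatype.\<close>

datatype poly_expr = PX | PY | PConst rat | PAdd poly_expr poly_expr | PMult poly_expr poly_expr

instance poly_expr :: countable by countable_datatype

primrec poly_eval :: "poly_expr \<Rightarrow> real \<times> real \<Rightarrow> real" where
  "poly_eval PX z = fst z"
| "poly_eval PY z = snd z"
| "poly_eval (PConst c) z = of_rat c"
| "poly_eval (PAdd e e') z = poly_eval e z + poly_eval e' z"
| "poly_eval (PMult e e') z = poly_eval e z * poly_eval e' z"

lemma second_order_poly_eval: "second_order (poly_eval e)"
proof (induction e)
  case PX show ?case using second_order_affine[of 1 0 0] by simp
next
  case PY show ?case using second_order_affine[of 0 1 0] by simp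
next
  case (PConst c) show ?case using second_order_affine[of 0 0 "of_rat c"] by simp
next
  case (PAdd e1 e2) then show ?case using second_order_add by simp
next
  case (PMult e1 e2) then show ?case using second_order_mult by simp
qed

lemma continuous_on_poly_eval: "continuous_on S (poly_eval e)"
proof (induction e)
  case PX
  have "continuous_on S (\<lambda>z. fst z)" by (intro continuous_intros)
  then show ?case by (rule continuous_on_eq) (simp only: poly_eval.simps)
next
  case PY
  have "continuous_on S (\<lambda>z. snd z)" by (intro continuous_intros)
  then show ?case by (rule continuous_on_eq) (simp only: poly_eval.simps)
next
  case (PConst c)
  have "continuous_on S (\<lambda>_. of_rat c)" by (intro continuous_intros)
  then show ?case by (rule continuous_on_eq) (simp only: poly_eval.simps)
next
  case (PAdd e e')
  have "continuous_on S (\<lambda>z. poly_eval e z + poly_eval e' z)" by (intro continuous_on_add PAdd.IH)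
  then show ?case by (rule continuous_on_eq) (simp only: poly_eval.simps)
next
  case (PMult e e')
  have "continuous_on S (\<lambda>z. poly_eval e z * poly_eval e' z)" by (intro continuous_on_mult PMult.IH)
  then show ?case by (rule continuous_on_eq) (simp only: poly_eval.simps)
qed

lemma compact_unit_square: "compact unit_square"
  by (intro compact_Times) auto

lemma continuous_on_square_bounded:
  fixes f :: "real \<times> real \<Rightarrow> 'b::real_normed_vector"
  assumes "continuous_on unit_square f"
  obtains B where "\<And>z. z \<in> unit_square \<Longrightarrow> norm (f z) \<le> B"
proof -
  have "bounded (f ` unit_square)"
    using compact_continuous_image[OF assms compact_unit_square] compact_imp_bounded by blast
  then show thesis using that unfolding bounded_iff by auto
qed

text \<open>Together with the Stone-Weierstrass theorem this makes the rational polynomials dense. The products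
need the second factor to be approximated after the first, since the admissible error of
\<open>e'\<close> depends on the size of \<open>e\<close> on the square.\<close>

lemma poly_expr_approx_polynomial:
  assumes "real_polynomial_function p" "0 < \<epsilon>"
  shows "\<exists>e. \<forall>z\<in>unit_square. \<bar>p z - poly_eval e z\<bar> < \<epsilon>"
  using assms
proof (induction arbitrary: \<epsilon> rule: real_polynomial_function.induct)
  case (const c)
  obtain q where q: "c < of_rat q" "of_rat q < c + \<epsilon>"
    using of_rat_dense[of c "c + \<epsilon>"] const by (metis less_add_same_cancel1)
  show ?case by (rule exI[of _ "PConst q"]) (use q in auto)
next
  case (add f g)
  obtain e where e: "\<forall>z\<in>unit_square. \<bar>f z - poly_eval e z\<bar> < \<epsilon> / 2" using add.IH(1)[of "\<epsilon> / 2"] add.prems by auto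
  obtain e' where e': "\<forall>z\<in>unit_square. \<bar>g z - poly_eval e' z\<bar> < \<epsilon> / 2" using add.IH(2)[of "\<epsilon> / 2"] add.prems by auto
  show ?case
  proof (intro exI[of _ "PAdd e e'"] ballI)
    fix z :: "real \<times> real" assume "z \<in> unit_square"
    then have "\<bar>f z - poly_eval e z\<bar> < \<epsilon> / 2" "\<bar>g z - poly_eval e' z\<bar> < \<epsilon> / 2" using e e' by blast+
    then show "\<bar>f z + g z - poly_eval (PAdd e e') z\<bar> < \<epsilon>" unfolding poly_eval.simps by linarith
  qed
next
  case (mult f g)
  have bdd: "\<exists>K>0. \<forall>z\<in>unit_square. \<bar>h z\<bar> \<le> K" if "continuous_on unit_square h" for h :: "real \<times> real \<Rightarrow> real"
  proof -
    have "bounded (h ` unit_square)" using compact_continuous_image[OF that compact_unit_square] compact_imp_bounded by blast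
    then show ?thesis unfolding bounded_pos by auto
  qed
  obtain K where K: "K > 0" "\<forall>z\<in>unit_square. \<bar>g z\<bar> \<le> K"
    using bdd[OF continuous_on_polymonial_function, of g] mult.hyps(2) real_polynomial_function_eq[of g] by auto
  obtain e where e: "\<forall>z\<in>unit_square. \<bar>f z - poly_eval e z\<bar> < \<epsilon> / (2 * K)"
    using mult.IH(1)[of "\<epsilon> / (2 * K)"] mult.prems K by auto
  obtain L where L: "L > 0" "\<forall>z\<in>unit_square. \<bar>poly_eval e z\<bar> \<le> L"
    using bdd[OF continuous_on_poly_eval] by blast
  obtain e' where e': "\<forall>z\<in>unit_square. \<bar>g z - poly_eval e' z\<bar> < \<epsilon> / (2 * L)"
    using mult.IH(2)[of "\<epsilon> / (2 * L)"] mult.prems L by auto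
  show ?case
  proof (intro exI[of _ "PMult e e'"] ballI)
    fix z :: "real \<times> real" assume z: "z \<in> unit_square"
    have eq: "f z * g z - poly_eval (PMult e e') z = (f z - poly_eval e z) * g z + poly_eval e z * (g z - poly_eval e' z)"
      by (simp add: algebra_simps)
    have "\<bar>(f z - poly_eval e z) * g z\<bar> \<le> \<bar>f z - poly_eval e z\<bar> * K"
      unfolding abs_mult using K z by (intro mult_left_mono) auto
    also have "\<dots> < \<epsilon> / (2 * K) * K" using e z K by (intro mult_strict_right_mono) auto
    finally have 1: "\<bar>(f z - poly_eval e z) * g z\<bar> < \<epsilon> / 2" using K by simp
    have "\<bar>poly_eval e z * (g z - poly_eval e' z)\<bar> \<le> L * \<bar>g z - poly_eval e' z\<bar>"
      unfolding abs_mult using L z by (intro mult_right_mono) auto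
    also have "\<dots> < L * (\<epsilon> / (2 * L))" using e' z L by (intro mult_strict_left_mono) auto
    finally have 2: "\<bar>poly_eval e z * (g z - poly_eval e' z)\<bar> < \<epsilon> / 2" using L by simp
    show "\<bar>f z * g z - poly_eval (PMult e e') z\<bar> < \<epsilon>" unfolding eq using 1 2 by linarith
  qed
next
  case (linear f)
  note eps = linear(2)
  interpret bounded_linear f by (rule linear(1))
  define a b where "a = f (1,0)" and "b = f (0,1)"
  have f: "f z = a * fst z + b * snd z" for z
  proof -
    have "z = fst z *\<^sub>R (1,0) + snd z *\<^sub>R (0,1)" by (cases z) auto
    then have "f z = f (fst z *\<^sub>R (1,0) + snd z *\<^sub>R (0,1))" by simp
    then show ?thesis unfolding add scaleR a_def b_def by simp
  qed
  obtain q where q: "a < of_rat q" "of_rat q < a + \<epsilon> / 2"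
    using of_rat_dense[of a "a + \<epsilon> / 2"] eps by (metis half_gt_zero less_add_same_cancel1)
  obtain r where r: "b < of_rat r" "of_rat r < b + \<epsilon> / 2"
    using of_rat_dense[of b "b + \<epsilon> / 2"] eps by (metis half_gt_zero less_add_same_cancel1)
  show ?case
  proof (intro exI[of _ "PAdd (PMult (PConst q) PX) (PMult (PConst r) PY)"] ballI)
    fix z :: "real \<times> real" assume z: "z \<in> unit_square"
    have *: "\<bar>c * x\<bar> < \<epsilon> / 2" if "\<bar>c\<bar> < \<epsilon> / 2" "0 \<le> x" "x \<le> 1" for c x :: real
    proof -
      have "\<bar>c * x\<bar> \<le> \<bar>c\<bar> * 1" unfolding abs_mult using that by (intro mult_left_mono) auto
      then show ?thesis using that by simp
    qed
    have eq: "f z - poly_eval (PAdd (PMult (PConst q) PX) (PMult (PConst r) PY)) z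
      = (a - of_rat q) * fst z + (b - of_rat r) * snd z" by (simp add: f algebra_simps)
    show "\<bar>f z - poly_eval (PAdd (PMult (PConst q) PX) (PMult (PConst r) PY)) z\<bar> < \<epsilon>"
      unfolding eq using *[of "a - of_rat q" "fst z"] *[of "b - of_rat r" "snd z"] q r z
      by (auto simp: mem_Times_iff)
  qed
qed

lemma poly_expr_dense:
  assumes "continuous_on unit_square f" "0 < \<epsilon>"
  obtains e where "\<And>z. z \<in> unit_square \<Longrightarrow> \<bar>f z - poly_eval e z\<bar> < \<epsilon>"
proof -
  obtain p where p: "real_polynomial_function p" "\<And>z. z \<in> unit_square \<Longrightarrow> \<bar>f z - p z\<bar> < \<epsilon> / 2"
    using Stone_Weierstrass_real_polynomial_function[OF compact_unit_square assms(1), of "\<epsilon> / 2"] assms(2) by auto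
  obtain e where e: "\<forall>z\<in>unit_square. \<bar>p z - poly_eval e z\<bar> < \<epsilon> / 2"
    using poly_expr_approx_polynomial[OF p(1), of "\<epsilon> / 2"] assms(2) by auto
  show thesis
  proof
    fix z :: "real \<times> real" assume "z \<in> unit_square"
    then have "\<bar>f z - p z\<bar> < \<epsilon> / 2" "\<bar>p z - poly_eval e z\<bar> < \<epsilon> / 2" using p e by blast+
    then show "\<bar>f z - poly_eval e z\<bar> < \<epsilon>" by linarith
  qed
qed

section \<open>The effect of one growth step on averages over the graph\<close>

definition perms :: "nat \<Rightarrow> nat list set" where
  "perms n = {w. length w = n \<and> set w = {1..n}}"

lemma perms_length: "w \<in> perms n \<Longrightarrow> length w = n" by (simp add: perms_def)

lemma perms_distinct: "w \<in> perms n \<Longrightarrow> distinct w"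
  by (auto simp: perms_def intro: card_distinct)

lemma perms_nth:
  assumes "w \<in> perms n" "i < n" shows "1 \<le> w ! i" "w ! i \<le> n"
  using nth_mem[of i w] assms by (auto simp: perms_def)

lemma perms_bij: "w \<in> perms n \<Longrightarrow> bij_betw (\<lambda>i. w ! i) {..<n} {1..n}"
  using bij_betw_nth[of w "{..<n}" "{1..n}"] perms_distinct[of w n] by (auto simp: perms_def)

lemma sum_split_at:
  fixes G :: "nat \<Rightarrow> real"
  assumes "k < n" shows "(\<Sum>i<n. G i) = (\<Sum>i<k. G i) + G k + (\<Sum>i=Suc k..<n. G i)"
proof -
  have "(\<Sum>i<n. G i) = (\<Sum>i=0..<k. G i) + (\<Sum>i=k..<n. G i)"
    using assms by (simp add: lessThan_atLeast0 sum.atLeastLessThan_concat)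
  also have "(\<Sum>i=k..<n. G i) = G k + (\<Sum>i=Suc k..<n. G i)"
    using assms by (rule sum.atLeast_Suc_lessThan)
  finally show ?thesis by (simp add: lessThan_atLeast0)
qed

lemma grow_append: "grow j b (xs @ ys) = grow j b xs @ grow j b ys"
  by (simp add: grow_def)

lemma grow_notin: "j \<notin> set xs \<Longrightarrow> grow j b xs = map (\<lambda>v. v + of_bool (j < v)) xs"
  by (induction xs) (auto simp: grow_def)

lemma grow_decomp:
  assumes "w \<in> perms n" "k < n"
  shows "grow (w ! k) b w = map (\<lambda>v. v + of_bool (w ! k < v)) (take k w) @
    [w ! k + of_bool (\<not> b), w ! k + of_bool b] @ map (\<lambda>v. v + of_bool (w ! k < v)) (drop (Suc k) w)"
proof -
  define j where "j = w ! k"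
  have l: "k < length w" using assms perms_length by auto
  have w: "w = take k w @ [j] @ drop (Suc k) w" using id_take_nth_drop[OF l] by (simp add: j_def)
  have "distinct (take k w @ [j] @ drop (Suc k) w)" using perms_distinct[OF assms(1)] w by simp
  then have "j \<notin> set (take k w)" "j \<notin> set (drop (Suc k) w)" by auto
  moreover have "grow j b [j] = [j + of_bool (\<not> b), j + of_bool b]" by (simp add: grow_def)
  moreover have "grow j b w = grow j b (take k w) @ grow j b [j] @ grow j b (drop (Suc k) w)"
    by (subst w) (simp only: grow_append)
  ultimately show ?thesis by (simp add: grow_notin j_def)
qed

lemma grow_perms:
  assumes "w \<in> perms n" "j \<in> {1..n}"
  shows "grow j b w \<in> perms (Suc n)"
proof -
  obtain k where k: "k < n" "j = w ! k"
    using assms unfolding perms_def by (metis (mono_tags, lifting) in_set_conv_nth mem_Collect_eq)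
  have len: "length (grow j b w) = Suc n"
    using k perms_length[OF assms(1)] by (simp add: grow_decomp[OF assms(1)])
  have "set (grow j b w) = {1..Suc n}"
  proof (intro set_eqI iffI)
    fix v assume "v \<in> set (grow j b w)"
    then show "v \<in> {1..Suc n}" using assms unfolding grow_def perms_def
      by (auto split: if_splits)
  next
    fix v assume v: "v \<in> {1..Suc n}"
    consider "v < j" | "v = j" | "v = j + 1" | "v > j + 1" by linarith
    then show "v \<in> set (grow j b w)"
    proof cases
      case 1
      then have "v \<in> set w" using v assms by (auto simp: perms_def)
      then show ?thesis using 1 by (auto simp: grow_def)
    next
      case 4
      then have "v - 1 \<in> set w" using v assms by (auto simp: perms_def)
      then show ?thesis using 4 unfolding grow_def by (auto intro!: bexI[of _ "v - 1"])
    qed (use assms in \<open>auto simp: grow_def perms_def\<close>)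
  qed
  then show ?thesis using len by (simp add: perms_def)
qed

text \<open>The key to comparing consecutive sizes: the entries of the grown word are those of the old one,
with positions after \<open>k\<close> and values above \<open>w ! k\<close> raised by one, except that the entry at
\<open>k\<close> itself is replaced by two neighbours.\<close>

lemma sum_grow:
  fixes F :: "nat \<Rightarrow> nat \<Rightarrow> real"
  assumes w: "w \<in> perms n" and k: "k < n"
  shows "(\<Sum>i<Suc n. F i (grow (w ! k) b w ! i)) =
    (\<Sum>i<n. F (i + of_bool (k < i)) (w ! i + of_bool (w ! k < w ! i))) - F k (w ! k)
      + F k (w ! k + of_bool (\<not> b)) + F (Suc k) (w ! k + of_bool b)"
proof -
  define w' where "w' = grow (w ! k) b w"
  define sh where "sh v = v + of_bool (w ! k < v)" for v
  have l: "length w = n" using perms_length[OF w] .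
  have d: "w' = map sh (take k w) @ [w ! k + of_bool (\<not> b), w ! k + of_bool b] @ map sh (drop (Suc k) w)"
    unfolding w'_def sh_def by (rule grow_decomp[OF w k])
  have n1: "w' ! i = sh (w ! i)" if "i < k" for i
    using that k l by (simp add: d nth_append)
  have n2: "w' ! k = w ! k + of_bool (\<not> b)" "w' ! (Suc k) = w ! k + of_bool b"
    using k l by (simp_all add: d nth_append)
  have n3: "w' ! (Suc i) = sh (w ! i)" if "k < i" "i < n" for i
  proof -
    have "Suc i - k = Suc (Suc (i - Suc k))" using that by simp
    then show ?thesis using that k l by (simp add: d nth_append)
  qed
  have "(\<Sum>i<Suc n. F i (w' ! i)) = (\<Sum>i<k. F i (w' ! i)) + F k (w' ! k) + (\<Sum>i=Suc k..<Suc n. F i (w' ! i))"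
    using k by (intro sum_split_at) auto
  also have "(\<Sum>i=Suc k..<Suc n. F i (w' ! i)) = (\<Sum>i=k..<n. F (Suc i) (w' ! (Suc i)))"
    by (rule sum.shift_bounds_Suc_ivl)
  also have "\<dots> = F (Suc k) (w' ! (Suc k)) + (\<Sum>i=Suc k..<n. F (Suc i) (w' ! (Suc i)))"
    using k by (rule sum.atLeast_Suc_lessThan)
  also have "(\<Sum>i=Suc k..<n. F (Suc i) (w' ! (Suc i))) = (\<Sum>i=Suc k..<n. F (i + of_bool (k < i)) (sh (w ! i)))"
    by (intro sum.cong) (auto simp: n3)
  also have "(\<Sum>i<k. F i (w' ! i)) = (\<Sum>i<k. F (i + of_bool (k < i)) (sh (w ! i)))"
    by (intro sum.cong) (auto simp: n1)
  finally have "(\<Sum>i<Suc n. F i (w' ! i)) = (\<Sum>i<k. F (i + of_bool (k < i)) (sh (w ! i))) +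
      F k (w ! k + of_bool (\<not> b)) + (F (Suc k) (w ! k + of_bool b)
      + (\<Sum>i=Suc k..<n. F (i + of_bool (k < i)) (sh (w ! i))))" by (simp only: n2)
  moreover have "(\<Sum>i<n. F (i + of_bool (k < i)) (sh (w ! i))) =
     (\<Sum>i<k. F (i + of_bool (k < i)) (sh (w ! i))) + F k (w ! k)
     + (\<Sum>i=Suc k..<n. F (i + of_bool (k < i)) (sh (w ! i)))"
    using sum_split_at[OF k, of "\<lambda>i. F (i + of_bool (k < i)) (sh (w ! i))"] by (simp add: sh_def)
  ultimately show ?thesis unfolding w'_def sh_def by linarith
qed

text \<open>List positions start at \<open>0\<close>, so the entry at index \<open>i\<close> sits at abscissa \<open>(i + 1) / n\<close>.\<close>

definition graph_avg :: "(real \<times> real \<Rightarrow> real) \<Rightarrow> nat list \<Rightarrow> real" where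
  "graph_avg f w = (\<Sum>i<length w. f ((real i + 1) / real (length w), real (w ! i) / real (length w))) / real (length w)"

context
  fixes f gx gy :: "real \<times> real \<Rightarrow> real" and C :: real and w :: "nat list" and n :: nat
  assumes f: "second_order_bound f gx gy C" and w: "w \<in> perms n" and n: "0 < n"
begin

definition old_pt :: "nat \<Rightarrow> real \<times> real" where
  "old_pt i = ((real i + 1) / real n, real (w ! i) / real n)"

text \<open>Where the point with index \<open>i\<close> goes when the entry at index \<open>k\<close> is split. For \<open>i = k\<close> this
is a fictitious point next to the two points that replace the old one.\<close>

definition new_pt :: "nat \<Rightarrow> nat \<Rightarrow> real \<times> real" where
  "new_pt k i = ((real i + of_bool (k < i) + 1) / real (Suc n), (real (w ! i) + of_bool (w ! k < w ! i)) / real (Suc n))"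

lemma old_pt_in: "i < n \<Longrightarrow> old_pt i \<in> unit_square"
  using perms_nth[OF w, of i] by (auto simp: old_pt_def)

lemma new_pt_in: "i < n \<Longrightarrow> new_pt k i \<in> unit_square"
  using perms_nth[OF w, of i] by (auto simp: new_pt_def divide_le_eq)

text \<open>The exact cancellation behind the small drift: passing from denominator \<open>n\<close> to \<open>n + 1\<close> pulls
a coordinate back by \<open>x/n\<close> units of size \<open>1/(n + 1)\<close>, and a uniform split pushes it forward by
one unit with almost the same probability.\<close>

lemma displacement_eq:
  fixes x \<epsilon> :: real shows "(x + \<epsilon>) / real (Suc n) - x / real n = (\<epsilon> - x / real n) / real (Suc n)"
  using n by (simp add: field_simps)

lemma fst_displacement: "fst (new_pt k i) - fst (old_pt i) = (of_bool (k < i) - (real i + 1) / real n) / real (Suc n)"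
  using displacement_eq[of "real i + 1" "of_bool (k < i)"] by (simp add: new_pt_def old_pt_def add_ac)

lemma snd_displacement: "snd (new_pt k i) - snd (old_pt i) = (of_bool (w ! k < w ! i) - real (w ! i) / real n) / real (Suc n)"
  using displacement_eq[of "real (w ! i)" "of_bool (w ! k < w ! i)"] by (simp add: new_pt_def old_pt_def add_ac)

lemma displacement_bound:
  fixes x \<epsilon> :: real
  assumes "0 \<le> x" "x \<le> real n" "0 \<le> \<epsilon>" "\<epsilon> \<le> 1"
  shows "\<bar>(\<epsilon> - x / real n) / real (Suc n)\<bar> \<le> 1 / real (Suc n)"
proof -
  have "0 \<le> x / real n" "x / real n \<le> 1" using assms n by auto
  then have "\<bar>\<epsilon> - x / real n\<bar> \<le> 1" using assms by linarith
  then show ?thesis unfolding abs_divide by (intro divide_mono) auto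
qed

lemma point_displacement_bounds:
  assumes "i < n"
  shows "\<bar>fst (new_pt k i) - fst (old_pt i)\<bar> \<le> 1 / real (Suc n)"
    and "\<bar>snd (new_pt k i) - snd (old_pt i)\<bar> \<le> 1 / real (Suc n)"
  unfolding fst_displacement snd_displacement using assms perms_nth[OF w assms]
  by (intro displacement_bound; simp)+

lemma C_nonneg: "0 \<le> C" by (rule second_order_bound_nonneg[OF f])

lemma f_small_move:
  assumes "u \<in> unit_square" "v \<in> unit_square" "\<bar>fst v - fst u\<bar> \<le> 1 / real (Suc n)" "\<bar>snd v - snd u\<bar> \<le> 1 / real (Suc n)"
  shows "\<bar>f v - f u\<bar> \<le> 4 * C / real (Suc n)"
proof -
  have "\<bar>f v - f u\<bar> \<le> 2 * C * (\<bar>fst v - fst u\<bar> + \<bar>snd v - snd u\<bar>)"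
    by (rule second_order_bound_lipschitz[OF f assms(1,2)])
  also have "\<dots> \<le> 2 * C * (1 / real (Suc n) + 1 / real (Suc n))"
    using assms C_nonneg by (intro mult_left_mono add_mono) auto
  finally show ?thesis by simp
qed

lemma graph_avg_old: "real n * graph_avg f w = (\<Sum>i<n. f (old_pt i))"
  using n perms_length[OF w] by (simp add: graph_avg_def old_pt_def)

lemma graph_avg_abs_le: "\<bar>graph_avg f w\<bar> \<le> C"
proof -
  have "\<bar>real n * graph_avg f w\<bar> \<le> (\<Sum>i<n. C)" unfolding graph_avg_old
    by (intro order_trans[OF sum_abs] sum_mono second_order_boundD(1)[OF f] old_pt_in) auto
  then have "real n * \<bar>graph_avg f w\<bar> \<le> real n * C" by (simp add: abs_mult)
  then show ?thesis using n by simp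
qed

text \<open>The change of the average splits into the displacements of the \<open>n\<close> old points and the
contribution of one additional point, which up to \<open>O(1/n)\<close> is a copy of the split point. The second
bracket sums to \<open>0\<close> over \<open>k\<close>.\<close>

lemma grow_step:
  assumes k: "k < n"
  shows "\<bar>real (Suc n) * (graph_avg f (grow (w ! k) b w) - graph_avg f w)
     - ((\<Sum>i<n. f (new_pt k i) - f (old_pt i)) + (f (old_pt k) - graph_avg f w))\<bar> \<le> 8 * C / real (Suc n)"
proof -
  define u1 u2 where "u1 = ((real k + 1) / real (Suc n), (real (w ! k) + of_bool (\<not> b)) / real (Suc n))"
    and "u2 = ((real k + 2) / real (Suc n), (real (w ! k) + of_bool b) / real (Suc n))"
  define w' where "w' = grow (w ! k) b w"
  have pk: "1 \<le> w ! k" "w ! k \<le> n" using perms_nth[OF w k] .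
  have "w' \<in> perms (Suc n)" unfolding w'_def by (rule grow_perms[OF w]) (use pk in auto)
  then have l: "length w' = Suc n" by (rule perms_length)
  have "real (Suc n) * graph_avg f w' = (\<Sum>i<Suc n. f ((real i + 1) / real (Suc n), real (w' ! i) / real (Suc n)))"
    unfolding graph_avg_def l by simp
  also have "\<dots> = (\<Sum>i<n. f (new_pt k i)) - f (new_pt k k) + f u1 + f u2"
    unfolding w'_def sum_grow[OF w k, of "\<lambda>i v. f ((real i + 1) / real (Suc n), real v / real (Suc n))"]
    by (simp add: new_pt_def u1_def u2_def add_ac)
  finally have eq: "real (Suc n) * graph_avg f w' = (\<Sum>i<n. f (new_pt k i)) - f (new_pt k k) + f u1 + f u2" .
  have u1: "u1 \<in> unit_square" using k pk by (auto simp: u1_def divide_le_eq)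
  have u2: "u2 \<in> unit_square" using k pk by (auto simp: u2_def divide_le_eq)
  have d1: "\<bar>f u1 - f (new_pt k k)\<bar> \<le> 4 * C / real (Suc n)"
    by (rule f_small_move[OF new_pt_in[OF k] u1]) (auto simp: u1_def new_pt_def simp flip: diff_divide_distrib)
  have e1: "fst u2 - fst (old_pt k) = (1 - (real k + 1) / real n) / real (Suc n)"
    using displacement_eq[of "real k + 1" 1] by (simp add: u2_def old_pt_def add_ac)
  have e2: "snd u2 - snd (old_pt k) = (of_bool b - real (w ! k) / real n) / real (Suc n)"
    using displacement_eq[of "real (w ! k)" "of_bool b"] by (simp add: u2_def old_pt_def)
  have d2: "\<bar>f u2 - f (old_pt k)\<bar> \<le> 4 * C / real (Suc n)"
    by (rule f_small_move[OF old_pt_in[OF k] u2]; unfold e1 e2; rule displacement_bound) (use k pk in auto)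
  have "real (Suc n) * (graph_avg f w' - graph_avg f w)
     - ((\<Sum>i<n. f (new_pt k i) - f (old_pt i)) + (f (old_pt k) - graph_avg f w))
     = (f u1 - f (new_pt k k)) + (f u2 - f (old_pt k))"
    unfolding right_diff_distrib eq sum_subtractf graph_avg_old[symmetric] by (simp add: algebra_simps)
  then show ?thesis using d1 d2 unfolding w'_def by linarith
qed

lemma grow_step_bound:
  assumes k: "k < n"
  shows "\<bar>graph_avg f (grow (w ! k) b w) - graph_avg f w\<bar> \<le> 14 * C / real (Suc n)"
proof -
  define D where "D = graph_avg f (grow (w ! k) b w) - graph_avg f w"
  have "\<bar>\<Sum>i<n. f (new_pt k i) - f (old_pt i)\<bar> \<le> (\<Sum>i<n. 4 * C / real (Suc n))"
    by (intro order_trans[OF sum_abs] sum_mono f_small_move old_pt_in new_pt_in point_displacement_bounds) auto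
  also have "\<dots> = (real n / real (Suc n)) * (4 * C)" by simp
  also have "\<dots> \<le> 1 * (4 * C)" using C_nonneg by (intro mult_right_mono) auto
  finally have 1: "\<bar>\<Sum>i<n. f (new_pt k i) - f (old_pt i)\<bar> \<le> 4 * C" by simp
  have 2: "\<bar>f (old_pt k)\<bar> \<le> C" by (rule second_order_boundD(1)[OF f old_pt_in[OF k]])
  have "8 * C / real (Suc n) \<le> 8 * C / 1" using C_nonneg by (intro divide_left_mono) auto
  then have "\<bar>real (Suc n) * D\<bar> \<le> 14 * C"
    using 1 2 grow_step[OF k, of b] graph_avg_abs_le unfolding D_def[symmetric] by linarith
  then have "real (Suc n) * \<bar>D\<bar> \<le> 14 * C" by (simp add: abs_mult)
  then show ?thesis unfolding D_def[symmetric] by (simp add: pos_le_divide_eq mult.commute)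
qed

text \<open>Exactly \<open>i\<close> of the \<open>n\<close> split indices lie before \<open>i\<close>, one short of \<open>i + 1\<close>.\<close>

lemma sum_fst_displacement:
  assumes "i < n"
  shows "(\<Sum>k<n. fst (new_pt k i) - fst (old_pt i)) = - 1 / real (Suc n)"
proof -
  have "(\<Sum>k<n. of_bool (k < i) :: real) = real (card ({..<n} \<inter> {k. k < i}))"
    by (simp add: of_bool_def sum.If_cases)
  also have "{..<n} \<inter> {k. k < i} = {..<i}" using assms by auto
  finally have "(\<Sum>k<n. of_bool (k < i) :: real) = real i" by simp
  then have "(\<Sum>k<n. of_bool (k < i) - (real i + 1) / real n) = -1"
    using n by (simp add: sum_subtractf)
  then show ?thesis unfolding fst_displacement by (simp flip: sum_divide_distrib)
qed

text \<open>The values at the split indices run through \<open>{1..n}\<close>, so \<open>w ! i - 1\<close> of them lie below \<open>w ! i\<close>.\<close>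

lemma sum_snd_displacement:
  assumes "i < n"
  shows "(\<Sum>k<n. snd (new_pt k i) - snd (old_pt i)) = - 1 / real (Suc n)"
proof -
  have "(\<Sum>k<n. of_bool (w ! k < w ! i) :: real) = (\<Sum>v\<in>{1..n}. of_bool (v < w ! i))"
    by (rule sum.reindex_bij_betw[OF perms_bij[OF w]])
  also have "\<dots> = real (card ({1..n} \<inter> {v. v < w ! i}))"
    by (simp add: of_bool_def sum.If_cases)
  also have "{1..n} \<inter> {v. v < w ! i} = {1..<w ! i}" using perms_nth[OF w assms] by auto
  finally have "(\<Sum>k<n. of_bool (w ! k < w ! i) :: real) = real (w ! i) - 1"
    using perms_nth[OF w assms] by simp
  then have "(\<Sum>k<n. of_bool (w ! k < w ! i) - real (w ! i) / real n) = -1"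
    using n by (simp add: sum_subtractf)
  then show ?thesis unfolding snd_displacement by (simp flip: sum_divide_distrib)
qed

text \<open>In the sum over \<open>k\<close> the first-order terms nearly cancel, and each of the \<open>n\<close> remainders is
\<open>O(1/n\<^sup>2)\<close>. A single displacement of \<open>f\<close> is of the same order as the whole sum.\<close>

lemma sum_f_displacement:
  assumes i: "i < n"
  shows "\<bar>\<Sum>k<n. f (new_pt k i) - f (old_pt i)\<bar> \<le> 4 * C / real (Suc n)"
proof -
  define X Y where "X k = fst (new_pt k i) - fst (old_pt i)" and "Y k = snd (new_pt k i) - snd (old_pt i)" for k
  define R where "R k = f (new_pt k i) - f (old_pt i) - gx (old_pt i) * X k - gy (old_pt i) * Y k" for k
  have R: "\<bar>R k\<bar> \<le> C * (2 / (real (Suc n))\<^sup>2)" for k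
  proof -
    have "\<bar>R k\<bar> \<le> C * ((X k)\<^sup>2 + (Y k)\<^sup>2)"
      unfolding R_def X_def Y_def by (rule second_order_bound_remainder[OF f old_pt_in[OF i] new_pt_in[OF i]])
    also have "\<dots> \<le> C * ((1 / real (Suc n))\<^sup>2 + (1 / real (Suc n))\<^sup>2)"
      using point_displacement_bounds[OF i, of k] C_nonneg unfolding X_def Y_def
      by (intro mult_left_mono add_mono) (auto simp: abs_le_square_iff[symmetric])
    finally show ?thesis by (simp add: power_divide)
  qed
  have "\<bar>\<Sum>k<n. R k\<bar> \<le> (\<Sum>k<n. C * (2 / (real (Suc n))\<^sup>2))"
    by (intro order_trans[OF sum_abs] sum_mono R)
  also have "\<dots> = (real n / real (Suc n)) * (2 * C / real (Suc n))" by (simp add: power2_eq_square)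
  also have "\<dots> \<le> 1 * (2 * C / real (Suc n))" using C_nonneg by (intro mult_right_mono) auto
  finally have R': "\<bar>\<Sum>k<n. R k\<bar> \<le> 2 * C / real (Suc n)" by simp
  have "(\<Sum>k<n. f (new_pt k i) - f (old_pt i)) = (\<Sum>k<n. R k + gx (old_pt i) * X k + gy (old_pt i) * Y k)"
    by (simp add: R_def)
  also have "\<dots> = (\<Sum>k<n. R k) + gx (old_pt i) * (\<Sum>k<n. X k) + gy (old_pt i) * (\<Sum>k<n. Y k)"
    by (simp add: sum.distrib sum_distrib_left)
  also have "\<dots> = (\<Sum>k<n. R k) - (gx (old_pt i) + gy (old_pt i)) / real (Suc n)"
    unfolding X_def Y_def sum_fst_displacement[OF i] sum_snd_displacement[OF i] by (simp add: algebra_simps add_divide_distrib)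
  finally have eq: "(\<Sum>k<n. f (new_pt k i) - f (old_pt i)) = (\<Sum>k<n. R k) - (gx (old_pt i) + gy (old_pt i)) / real (Suc n)" .
  have "\<bar>gx (old_pt i)\<bar> \<le> C" "\<bar>gy (old_pt i)\<bar> \<le> C"
    by (rule second_order_boundD[OF f old_pt_in[OF i]])+
  then have "\<bar>gx (old_pt i) + gy (old_pt i)\<bar> \<le> 2 * C" by linarith
  then have "\<bar>(gx (old_pt i) + gy (old_pt i)) / real (Suc n)\<bar> \<le> 2 * C / real (Suc n)"
    unfolding abs_divide by (intro divide_mono) auto
  then show ?thesis using R' unfolding eq by linarith
qed

text \<open>The conditional mean of a step for a fixed flag \<open>b\<close>: the bound of \<open>grow_step\<close> summed over
all split indices, with the double sum of displacements evaluated point by point.\<close>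

lemma grow_step_drift:
  "\<bar>(\<Sum>j=1..n. graph_avg f (grow j b w) - graph_avg f w) / real n\<bar> \<le> 12 * C / (real (Suc n))\<^sup>2"
proof -
  define D where "D k = graph_avg f (grow (w ! k) b w) - graph_avg f w" for k
  define S where "S k = (\<Sum>i<n. f (new_pt k i) - f (old_pt i))" for k
  define G where "G k = f (old_pt k) - graph_avg f w" for k
  have re: "(\<Sum>j=1..n. graph_avg f (grow j b w) - graph_avg f w) = (\<Sum>k<n. D k)"
    unfolding D_def by (rule sum.reindex_bij_betw[OF perms_bij[OF w], symmetric])
  have G: "(\<Sum>k<n. G k) = 0" unfolding G_def using n by (simp add: sum_subtractf graph_avg_old)
  have "\<bar>\<Sum>k<n. real (Suc n) * D k - (S k + G k)\<bar> \<le> (\<Sum>k<n. 8 * C / real (Suc n))"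
    unfolding D_def S_def G_def by (intro order_trans[OF sum_abs] sum_mono grow_step) auto
  then have 1: "\<bar>real (Suc n) * (\<Sum>k<n. D k) - (\<Sum>k<n. S k)\<bar> \<le> real n * (8 * C / real (Suc n))"
    by (simp only: sum_subtractf sum.distrib G sum_distrib_left[symmetric]) simp
  have "(\<Sum>k<n. S k) = (\<Sum>i<n. \<Sum>k<n. f (new_pt k i) - f (old_pt i))"
    unfolding S_def by (rule sum.swap)
  also have "\<bar>\<dots>\<bar> \<le> (\<Sum>i<n. 4 * C / real (Suc n))"
    by (intro order_trans[OF sum_abs] sum_mono sum_f_displacement) auto
  finally have 2: "\<bar>\<Sum>k<n. S k\<bar> \<le> real n * (4 * C / real (Suc n))" by simp
  have abs_le: "\<bar>a\<bar> \<le> x + y" if "\<bar>a - s\<bar> \<le> x" "\<bar>s\<bar> \<le> y" for a s x y :: real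
    using that by linarith
  have *: "\<bar>real (Suc n) * (\<Sum>k<n. D k)\<bar> \<le> real n * (8 * C / real (Suc n)) + real n * (4 * C / real (Suc n))"
    by (rule abs_le[OF 1 2])
  define N where "N = real (Suc n)"
  have N: "0 < N" by (simp add: N_def)
  have "real n * (8 * C / N) + real n * (4 * C / N) = real n * (12 * C / N)"
    by (simp add: algebra_simps flip: add_divide_distrib)
  then have "N * \<bar>\<Sum>k<n. D k\<bar> \<le> real n * (12 * C / N)"
    using * N unfolding N_def[symmetric] by (simp add: abs_mult mult_ac)
  then have "\<bar>\<Sum>k<n. D k\<bar> \<le> real n * (12 * C / N) / N" using N by (simp only: pos_le_divide_eq mult.commute)
  then have "\<bar>\<Sum>k<n. D k\<bar> / real n \<le> real n * (12 * C / N) / N / real n" by (rule divide_right_mono) simp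
  also have "\<dots> = 12 * C / N\<^sup>2" using n by (simp add: power2_eq_square)
  finally show ?thesis unfolding re N_def[symmetric] by simp
qed

end

section \<open>A convergence criterion for sequences with small increments\<close>

lemma cube_floor: "1 \<le> n \<Longrightarrow> \<exists>k\<ge>1. k ^ 3 \<le> n \<and> n < (Suc k) ^ 3" for n :: nat
proof (induction n rule: nat_induct_at_least)
  case base show ?case by (rule exI[of _ 1]) (simp add: eval_nat_numeral)
next
  case (Suc n)
  then obtain k where k: "k \<ge> 1" "k ^ 3 \<le> n" "n < (Suc k) ^ 3" by auto
  show ?case
  proof (cases "Suc n < (Suc k) ^ 3")
    case True then show ?thesis using k by (intro exI[of _ k]) auto
  next
    case False
    then have "Suc n = (Suc k) ^ 3" using k by simp
    moreover have "(Suc k) ^ 3 < (Suc (Suc k)) ^ 3" by (rule power_strict_mono) auto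
    ultimately show ?thesis by (intro exI[of _ "Suc k"]) auto
  qed
qed

lemma increments_le:
  fixes a :: "nat \<Rightarrow> real"
  assumes "\<And>n. 1 \<le> n \<Longrightarrow> \<bar>a (Suc n) - a n\<bar> \<le> C / real n" "1 \<le> m" "0 \<le> C"
  shows "\<bar>a (m + d) - a m\<bar> \<le> C * real d / real m"
proof (induction d)
  case (Suc d)
  have "\<bar>a (Suc (m + d)) - a (m + d)\<bar> \<le> C / real (m + d)" using assms(2) by (intro assms(1)) simp
  also have "\<dots> \<le> C / real m" using assms by (intro divide_left_mono) auto
  finally have "\<bar>a (m + Suc d) - a m\<bar> \<le> C / real m + C * real d / real m" using Suc by simp
  then show ?case by (simp add: algebra_simps add_divide_distrib)
qed simp

lemma cube_gap: "1 \<le> k \<Longrightarrow> (Suc k) ^ 3 \<le> k ^ 3 + 7 * k ^ 2" for k :: nat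
proof -
  assume k: "1 \<le> k"
  then have "k \<le> k ^ 2" "1 \<le> k ^ 2" by (auto simp: power2_eq_square)
  moreover have "(Suc k) ^ 3 = k ^ 3 + 3 * k ^ 2 + 3 * k + 1" by (simp add: power2_eq_square power3_eq_cube algebra_simps)
  ultimately show ?thesis by linarith
qed

text \<open>Cubes serve two purposes. They are dense enough for increments of size \<open>C/n\<close> to be
negligible between \<open>k\<^sup>3\<close> and \<open>(k + 1)\<^sup>3\<close>, where they add up to \<open>O(k\<^sup>2/k\<^sup>3)\<close>, and sparse enough
for the absolute differences along them to be summable in the application below.\<close>

lemma convergent_from_cubes:
  fixes a :: "nat \<Rightarrow> real"
  assumes inc: "\<And>n. 1 \<le> n \<Longrightarrow> \<bar>a (Suc n) - a n\<bar> \<le> C / real n" and C: "0 \<le> C"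
    and sm: "summable (\<lambda>k. \<bar>a (Suc (Suc k) ^ 3) - a (Suc k ^ 3)\<bar>)"
  shows "convergent a"
proof -
  define b where "b k = a (Suc k ^ 3)" for k
  have "summable (\<lambda>k. b (Suc k) - b k)" using sm unfolding b_def by (rule summable_rabs_cancel)
  then have "(\<lambda>n. \<Sum>k<n. b (Suc k) - b k) \<longlonglongrightarrow> (\<Sum>k. b (Suc k) - b k)" by (rule summable_LIMSEQ)
  then have "(\<lambda>n. b n - b 0) \<longlonglongrightarrow> (\<Sum>k. b (Suc k) - b k)" by (simp add: sum_lessThan_telescope)
  then have "(\<lambda>n. (b n - b 0) + b 0) \<longlonglongrightarrow> (\<Sum>k. b (Suc k) - b k) + b 0" by (intro tendsto_intros)
  then obtain L where L: "b \<longlonglongrightarrow> L" by auto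
  obtain r where r: "\<And>n. 1 \<le> n \<Longrightarrow> 1 \<le> r n \<and> r n ^ 3 \<le> n \<and> n < (Suc (r n)) ^ 3"
    using cube_floor by metis
  have r_top: "filterlim r at_top sequentially"
    unfolding filterlim_at_top
  proof
    fix K :: nat
    show "\<forall>\<^sub>F n in sequentially. K \<le> r n"
    proof (rule eventually_sequentiallyI)
      fix n assume n: "Suc K ^ 3 \<le> n"
      have "1 \<le> Suc K ^ 3" by simp
      then have "1 \<le> n" using n by linarith
      then have "Suc K ^ 3 < Suc (r n) ^ 3" using r[OF \<open>1 \<le> n\<close>] n by linarith
      then show "K \<le> r n" using power_less_imp_less_base[of "Suc K" 3 "Suc (r n)"] by simp
    qed
  qed
  have "filterlim (\<lambda>n. r n - 1) at_top sequentially"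
    by (rule filterlim_compose[OF filterlim_minus_const_nat_at_top r_top])
  then have 1: "(\<lambda>n. b (r n - 1)) \<longlonglongrightarrow> L" by (rule filterlim_compose[OF L])
  have 2: "(\<lambda>n. a n - b (r n - 1)) \<longlonglongrightarrow> 0"
  proof (rule Lim_null_comparison)
    show "\<forall>\<^sub>F n in sequentially. norm (a n - b (r n - 1)) \<le> 7 * C * inverse (real (r n))"
    proof (rule eventually_sequentiallyI)
      fix n :: nat assume n: "1 \<le> n"
      \<comment> \<open>compare \<open>a n\<close> with \<open>a\<close> at the largest cube not exceeding \<open>n\<close>; the index of \<open>b\<close> is shifted by one\<close>
      define k where "k = r n"
      have k: "1 \<le> k" "k ^ 3 \<le> n" "n < Suc k ^ 3" using r[OF n] by (auto simp: k_def)
      obtain d where d: "n = k ^ 3 + d" using k(2) le_Suc_ex by blast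
      have "d \<le> 7 * k ^ 2" using cube_gap[OF k(1)] k(3) d by linarith
      then have "real d \<le> real (7 * k ^ 2)" by (rule of_nat_mono)
      then have d7: "real d \<le> 7 * real k ^ 2" by simp
      have "\<bar>a n - a (k ^ 3)\<bar> \<le> C * real d / real (k ^ 3)"
        unfolding d using k(1) by (intro increments_le inc C) auto
      also have "\<dots> \<le> C * (7 * real k ^ 2) / real (k ^ 3)"
        using d7 C by (intro divide_right_mono mult_left_mono) auto
      also have "\<dots> = 7 * C * inverse (real k)" using k(1) by (simp add: power2_eq_square power3_eq_cube field_simps)
      finally show "norm (a n - b (r n - 1)) \<le> 7 * C * inverse (real (r n))"
        using k(1) by (simp add: b_def k_def)
    qed
    have "(\<lambda>n. inverse (real (r n))) \<longlonglongrightarrow> 0"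
      by (rule filterlim_compose[OF lim_inverse_n r_top])
    then show "(\<lambda>n. 7 * C * inverse (real (r n))) \<longlonglongrightarrow> 0" by (rule tendsto_mult_right_zero)
  qed
  have "(\<lambda>n. b (r n - 1) + (a n - b (r n - 1))) \<longlonglongrightarrow> L + 0" by (rule tendsto_add[OF 1 2])
  then show ?thesis by (auto intro: convergentI)
qed

section \<open>Almost sure convergence along the growth chain\<close>

text \<open>The process as a function of its randomness \<open>x\<close>, where \<open>x n\<close> drives the step from size \<open>n\<close> to
\<open>n + 1\<close>. The value at \<open>0\<close> is a placeholder, so that the index is the size.\<close>

fun grow_path :: "nat \<Rightarrow> (nat \<Rightarrow> nat \<times> bool) \<Rightarrow> nat list" where
  "grow_path 0 x = []"
| "grow_path (Suc n) x = (if n = 0 then [1] else grow (fst (x n)) (snd (x n)) (grow_path n x))"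

lemma grow_path_cong: "(\<And>i. 1 \<le> i \<Longrightarrow> i < n \<Longrightarrow> x i = y i) \<Longrightarrow> grow_path n x = grow_path n y"
  by (induction n) auto

lemma grow_path_measurable:
  "{1..<n} \<subseteq> I \<Longrightarrow> grow_path n \<in> PiM I (\<lambda>_. count_space UNIV) \<rightarrow>\<^sub>M count_space UNIV"
proof (induction n)
  case (Suc n)
  show ?case
  proof (cases "n = 0")
    case False
    have IH: "grow_path n \<in> PiM I (\<lambda>_. count_space UNIV) \<rightarrow>\<^sub>M count_space UNIV"
      by (rule Suc.IH) (use Suc.prems in auto)
    have "(\<lambda>x. grow (fst (x n)) (snd (x n)) (grow_path n x)) \<in> PiM I (\<lambda>_. count_space UNIV) \<rightarrow>\<^sub>M count_space UNIV"
    proof (rule measurable_compose_countable[where g = "\<lambda>x. x n" and f = "\<lambda>i x. grow (fst i) (snd i) (grow_path n x)"])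
      show "(\<lambda>x. grow (fst i) (snd i) (grow_path n x)) \<in> PiM I (\<lambda>_. count_space UNIV) \<rightarrow>\<^sub>M count_space UNIV" for i :: "nat \<times> bool"
        by (rule measurable_compose[OF IH]) simp
      show "(\<lambda>x. x n) \<in> PiM I (\<lambda>_. count_space UNIV) \<rightarrow>\<^sub>M count_space (UNIV :: (nat \<times> bool) set)"
        using Suc.prems False by (intro measurable_component_singleton) auto
    qed
    then show ?thesis using False by simp
  qed simp
next
  case 0
  have "grow_path 0 = (\<lambda>_. [])" by (rule ext) simp
  then show ?case by simp
qed

lemma grow_path_perms:
  assumes "\<And>i. 1 \<le> i \<Longrightarrow> fst (x i) \<in> {1..i}" "1 \<le> n"
  shows "grow_path n x \<in> perms n"
  using assms(2)
proof (induction n rule: nat_induct_at_least)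
  case base show ?case by (simp add: perms_def)
next
  case (Suc n)
  then show ?case using grow_perms[OF Suc.IH assms(1)[OF Suc.hyps]] by simp
qed

text \<open>The average over the uniform index is taken first, for each value of the flag, so that a bound which is
uniform in the flag survives whatever the law of the flag is.\<close>

lemma pmf_drift:
  fixes G :: "nat \<Rightarrow> bool \<Rightarrow> real"
  assumes n: "1 \<le> n" and G: "\<And>b. \<bar>(\<Sum>j=1..n. G j b) / real n\<bar> \<le> c"
  shows "\<bar>\<integral>x. G (fst x) (snd x) \<partial>measure_pmf (pair_pmf (pmf_of_set {1..n}) q)\<bar> \<le> c"
proof -
  let ?P = "pair_pmf (pmf_of_set {1..n}) q"
  have "(\<integral>x. G (fst x) (snd x) \<partial>measure_pmf ?P) = (\<Sum>x\<in>{1..n} \<times> UNIV. G (fst x) (snd x) * pmf ?P x)"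
    using n by (subst integral_measure_pmf[where A = "{1..n} \<times> UNIV"]) (auto simp: mult.commute)
  also have "\<dots> = (\<Sum>j=1..n. \<Sum>b\<in>UNIV. G j b * pmf ?P (j, b))"
    by (subst sum.cartesian_product) (auto simp: case_prod_beta)
  also have "\<dots> = (\<Sum>b\<in>UNIV. \<Sum>j=1..n. G j b * pmf ?P (j, b))" by (rule sum.swap)
  also have "\<dots> = (\<Sum>b\<in>UNIV. pmf q b * ((\<Sum>j=1..n. G j b) / real n))"
    using n by (intro sum.cong) (auto simp: pmf_pair pmf_of_set sum_distrib_left sum_divide_distrib sum_distrib_right mult_ac intro!: sum.cong)
  finally have eq: "(\<integral>x. G (fst x) (snd x) \<partial>measure_pmf ?P) = (\<Sum>b\<in>UNIV. pmf q b * ((\<Sum>j=1..n. G j b) / real n))" .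
  have "\<bar>\<Sum>b\<in>UNIV. pmf q b * ((\<Sum>j=1..n. G j b) / real n)\<bar> \<le> (\<Sum>b\<in>UNIV. pmf q b * c)"
    
    unfolding abs_mult by (intro order_trans[OF sum_abs] sum_mono) (unfold abs_mult, intro mult_mono G, auto)
  also have "\<dots> = c" by (simp add: sum_pmf_eq_1 flip: sum_distrib_right)
  finally show ?thesis unfolding eq .
qed


locale growth_driver = prob_space M for M :: "'a measure" +
  fixes X :: "nat \<Rightarrow> 'a \<Rightarrow> nat \<times> bool" and q :: "bool pmf"
  assumes indep: "indep_vars (\<lambda>_. count_space UNIV) X {1..}"
    and distr_X: "1 \<le> n \<Longrightarrow> distr M (count_space UNIV) (X n) = measure_pmf (pair_pmf (pmf_of_set {1..n}) q)"
begin

definition chain :: "nat \<Rightarrow> 'a \<Rightarrow> nat list" where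
  "chain n \<omega> = grow_path n (\<lambda>i. X i \<omega>)"

lemma X_measurable [measurable]: "1 \<le> n \<Longrightarrow> X n \<in> M \<rightarrow>\<^sub>M count_space UNIV"
  using indep by (auto simp: indep_vars_def)

lemma chain_restrict: "n \<le> k \<Longrightarrow> chain n \<omega> = grow_path n (restrict (\<lambda>i. X i \<omega>) {1..<k})"
  unfolding chain_def by (rule grow_path_cong) auto

lemma chain_measurable [measurable]: "chain n \<in> M \<rightarrow>\<^sub>M count_space UNIV"
proof -
  have "(\<lambda>\<omega>. grow_path n (restrict (\<lambda>i. X i \<omega>) {1..<n})) \<in> M \<rightarrow>\<^sub>M count_space UNIV"
    by (rule measurable_compose[OF _ grow_path_measurable[of n "{1..<n}"]]) (auto intro!: measurable_restrict X_measurable)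
  then show ?thesis by (subst measurable_cong[OF chain_restrict[OF order_refl]])
qed

text \<open>The past up to size \<open>k\<close> is a function of the randomness with indices below \<open>k\<close>. Both sides
are encoded as natural numbers, as independence of two random variables is formulated
for variables with values in the same type.\<close>

lemma indep_chain_X:
  assumes "1 \<le> k" "n \<le> k"
  shows "indep_var (count_space UNIV) (\<lambda>\<omega>. to_nat (chain n \<omega>, chain k \<omega>)) (count_space UNIV) (\<lambda>\<omega>. to_nat (X k \<omega>))"
proof -
  have "indep_var (count_space UNIV) ((\<lambda>x. to_nat (grow_path n x, grow_path k x)) \<circ> (\<lambda>\<omega>. restrict (\<lambda>i. X i \<omega>) {1..<k}))
    (count_space UNIV) ((\<lambda>x. to_nat (x k)) \<circ> (\<lambda>\<omega>. restrict (\<lambda>i. X i \<omega>) {k}))"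
  proof (rule indep_var_compose[OF indep_var_restrict[OF indep]])
    have "(\<lambda>x. (grow_path n x, grow_path k x)) \<in> PiM {1..<k} (\<lambda>_. count_space UNIV) \<rightarrow>\<^sub>M count_space UNIV \<Otimes>\<^sub>M count_space UNIV"
      using assms by (intro measurable_Pair grow_path_measurable) auto
    then have "(\<lambda>x. (grow_path n x, grow_path k x)) \<in> PiM {1..<k} (\<lambda>_. count_space UNIV) \<rightarrow>\<^sub>M count_space UNIV"
      by (simp add: pair_measure_countable)
    then show "(\<lambda>x. to_nat (grow_path n x, grow_path k x)) \<in> PiM {1..<k} (\<lambda>_. count_space UNIV) \<rightarrow>\<^sub>M count_space UNIV"
      by (rule measurable_compose) simp
    have "(\<lambda>x. x k) \<in> PiM {k} (\<lambda>_. count_space UNIV) \<rightarrow>\<^sub>M count_space (UNIV :: (nat \<times> bool) set)"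
      by (rule measurable_component_singleton) simp
    then show "(\<lambda>x. to_nat (x k)) \<in> PiM {k} (\<lambda>_. count_space (UNIV :: (nat \<times> bool) set)) \<rightarrow>\<^sub>M count_space UNIV"
      by (rule measurable_compose) simp
  qed (use assms in auto)
  moreover have "(\<lambda>x. to_nat (grow_path n x, grow_path k x)) \<circ> (\<lambda>\<omega>. restrict (\<lambda>i. X i \<omega>) {1..<k}) = (\<lambda>\<omega>. to_nat (chain n \<omega>, chain k \<omega>))"
    using assms by (simp add: fun_eq_iff chain_restrict[OF assms(2)] chain_restrict[OF order_refl[of k]])
  moreover have "(\<lambda>x. to_nat (x k)) \<circ> (\<lambda>\<omega>. restrict (\<lambda>i. X i \<omega>) {k}) = (\<lambda>\<omega>. to_nat (X k \<omega>))"
    by (auto simp: fun_eq_iff)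
  ultimately show ?thesis by simp
qed

lemma AE_X: "AE \<omega> in M. \<forall>n\<ge>1. fst (X n \<omega>) \<in> {1..n}"
proof -
  have "AE \<omega> in M. fst (X n \<omega>) \<in> {1..n}" if n: "1 \<le> n" for n
  proof -
    have "AE x in distr M (count_space UNIV) (X n). fst x \<in> {1..n}"
      unfolding distr_X[OF n] using n by (auto simp: AE_measure_pmf_iff)
    then show ?thesis using n by (subst (asm) AE_distr_iff) auto
  qed
  then have "AE \<omega> in M. 1 \<le> n \<longrightarrow> fst (X n \<omega>) \<in> {1..n}" for n
    by (cases "1 \<le> n") simp_all
  then show ?thesis unfolding AE_all_countable by blast
qed

lemma AE_chain_perms: "AE \<omega> in M. \<forall>n\<ge>1. chain n \<omega> \<in> perms n"
  using AE_X
proof eventually_elim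
  case (elim \<omega>)
  then show ?case unfolding chain_def by (intro allI impI grow_path_perms) blast+
qed

lemma chain_Suc: "1 \<le> n \<Longrightarrow> chain (Suc n) \<omega> = grow (fst (X n \<omega>)) (snd (X n \<omega>)) (chain n \<omega>)"
  by (simp add: chain_def)

text \<open>A bounded statistic \<open>F\<close> whose steps are \<open>O(1/n)\<close> and have conditional mean \<open>O(1/n\<^sup>2)\<close> converges
along the chain.\<close>

context
  fixes F :: "nat list \<Rightarrow> real" and C :: real
  assumes F_bound: "\<And>w. \<bar>F w\<bar> \<le> C"
    and F_step: "\<And>n w j b. 1 \<le> n \<Longrightarrow> w \<in> perms n \<Longrightarrow> j \<in> {1..n} \<Longrightarrow> \<bar>F (grow j b w) - F w\<bar> \<le> C / real n"
    and F_drift: "\<And>n w b. 1 \<le> n \<Longrightarrow> w \<in> perms n \<Longrightarrow>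
      \<bar>(\<Sum>j=1..n. F (grow j b w) - F w) / real n\<bar> \<le> C / (real n)\<^sup>2"
begin

lemma F_bound_nonneg: "0 \<le> C" using F_bound[of "[]"] by linarith

lemma AE_step: "AE \<omega> in M. \<forall>n\<ge>1. \<bar>F (chain (Suc n) \<omega>) - F (chain n \<omega>)\<bar> \<le> C / real n"
  using AE_X AE_chain_perms
proof eventually_elim
  case (elim \<omega>)
  show ?case
  proof (intro allI impI)
    fix n :: nat assume n: "1 \<le> n"
    show "\<bar>F (chain (Suc n) \<omega>) - F (chain n \<omega>)\<bar> \<le> C / real n"
      unfolding chain_Suc[OF n] using elim n by (intro F_step) blast+
  qed
qed

lemma F_chain_measurable [measurable]: "(\<lambda>\<omega>. F (chain n \<omega>)) \<in> borel_measurable M"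
  by (rule measurable_compose[OF chain_measurable]) simp

lemma integrable_bounded: 
  assumes [measurable]: "g \<in> borel_measurable M" and "\<And>\<omega>. \<bar>g \<omega>\<bar> \<le> B"
  shows "integrable M (g :: 'a \<Rightarrow> real)"
  using assms by (intro integrable_const_bound[of _ B]) auto

text \<open>Conditionally on the past the first factor is a constant of size at most \<open>2 C\<close>, and the second has
mean at most \<open>C/k\<^sup>2\<close> in absolute value. By independence the conditioning is Fubini's theorem.\<close>

lemma cross_term:
  assumes k: "1 \<le> k" "n \<le> k"
  shows "\<bar>\<integral>\<omega>. (F (chain k \<omega>) - F (chain n \<omega>)) * (F (chain (Suc k) \<omega>) - F (chain k \<omega>)) \<partial>M\<bar> \<le> 2 * C\<^sup>2 / (real k)\<^sup>2"
proof -
  define Y where "Y \<omega> = to_nat (chain n \<omega>, chain k \<omega>)" for \<omega>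
  define Z where "Z \<omega> = to_nat (X k \<omega>)" for \<omega>
  define PX where "PX = distr M (count_space UNIV) Z"
  define PY where "PY = distr M (count_space UNIV) Y"
  define H where "H y x = (F (snd y) - F (fst y)) * (F (grow (fst x) (snd x) (snd y)) - F (snd y))"
    for y :: "nat list \<times> nat list" and x :: "nat \<times> bool"
  define h where "h y x = H (from_nat y) (from_nat x)" for y x
  have iv: "indep_var (count_space UNIV) Y (count_space UNIV) Z"
    unfolding Y_def Z_def by (rule indep_chain_X[OF k])
  have Y[measurable]: "Y \<in> M \<rightarrow>\<^sub>M count_space UNIV" by (rule indep_var_rv1[OF iv])
  have Z[measurable]: "Z \<in> M \<rightarrow>\<^sub>M count_space UNIV" by (rule indep_var_rv2[OF iv])
  have Xk[measurable]: "X k \<in> M \<rightarrow>\<^sub>M count_space UNIV" by (rule X_measurable[OF k(1)])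
  have joint: "PY \<Otimes>\<^sub>M PX = distr M (count_space UNIV \<Otimes>\<^sub>M count_space UNIV) (\<lambda>\<omega>. (Y \<omega>, Z \<omega>))"
    using iv unfolding indep_var_distribution_eq PY_def PX_def by simp
  interpret PX: prob_space PX unfolding PX_def by (rule prob_space_distr[OF Z])
  interpret PY: prob_space PY unfolding PY_def by (rule prob_space_distr[OF Y])
  interpret pair_prob_space PY PX ..
  have hm: "case_prod h \<in> borel_measurable (count_space UNIV \<Otimes>\<^sub>M count_space UNIV)"
    by (simp add: pair_measure_countable)
  have hm': "case_prod h \<in> borel_measurable (PY \<Otimes>\<^sub>M PX)"
    unfolding joint using hm by simp
  have diff: "\<bar>F v - F u\<bar> \<le> 2 * C" for u v using F_bound[of u] F_bound[of v] by linarith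
  have hb: "\<bar>h y x\<bar> \<le> (2 * C) * (2 * C)" for y x
    unfolding h_def H_def abs_mult by (intro mult_mono diff) (use F_bound_nonneg in auto)
  have hi: "integrable (PY \<Otimes>\<^sub>M PX) (case_prod h)"
    by (rule integrable_const_bound[of _ "(2 * C) * (2 * C)"]) (use hb hm' in auto)
  have "(\<integral>\<omega>. (F (chain k \<omega>) - F (chain n \<omega>)) * (F (chain (Suc k) \<omega>) - F (chain k \<omega>)) \<partial>M)
     = (\<integral>\<omega>. case_prod h (Y \<omega>, Z \<omega>) \<partial>M)"
    by (simp add: h_def H_def Y_def Z_def chain_Suc[OF k(1)])
  also have "\<dots> = (\<integral>z. case_prod h z \<partial>(PY \<Otimes>\<^sub>M PX))"
    unfolding joint by (rule integral_distr[symmetric, OF _ hm]) measurable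
  also have "\<dots> = (\<integral>y. (\<integral>x. h y x \<partial>PX) \<partial>PY)"
    using integral_fst'[OF hi] by simp
  also have "\<bar>\<dots>\<bar> \<le> (\<integral>y. 2 * C\<^sup>2 / (real k)\<^sup>2 \<partial>PY)"
  proof -
    have inner: "\<bar>\<integral>x. h y x \<partial>PX\<bar> \<le> 2 * C\<^sup>2 / (real k)\<^sup>2" if y: "snd (from_nat y :: nat list \<times> nat list) \<in> perms k" for y
    proof -
      define u v where "u = fst (from_nat y :: nat list \<times> nat list)" and "v = snd (from_nat y :: nat list \<times> nat list)"
      define P where "P = measure_pmf (pair_pmf (pmf_of_set {1..k}) q)"
      have "(\<integral>x. h y x \<partial>PX) = (\<integral>\<omega>. h y (Z \<omega>) \<partial>M)"
        unfolding PX_def by (rule integral_distr) auto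
      also have "\<dots> = (\<integral>\<omega>. (F v - F u) * (F (grow (fst (X k \<omega>)) (snd (X k \<omega>)) v) - F v) \<partial>M)"
        by (simp add: h_def H_def Z_def u_def v_def)
      also have "\<dots> = (\<integral>x. (F v - F u) * (F (grow (fst x) (snd x) v) - F v) \<partial>distr M (count_space UNIV) (X k))"
        by (rule integral_distr[symmetric]) auto
      also have "\<dots> = (F v - F u) * (\<integral>x. F (grow (fst x) (snd x) v) - F v \<partial>P)"
        unfolding distr_X[OF k(1)] P_def by simp
      finally have eq: "(\<integral>x. h y x \<partial>PX) = (F v - F u) * (\<integral>x. F (grow (fst x) (snd x) v) - F v \<partial>P)" .
      have "\<bar>\<integral>x. F (grow (fst x) (snd x) v) - F v \<partial>P\<bar> \<le> C / (real k)\<^sup>2"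
        unfolding P_def by (rule pmf_drift[OF k(1)]) (rule F_drift[OF k(1) y[folded v_def]])
      then have "\<bar>F v - F u\<bar> * \<bar>\<integral>x. F (grow (fst x) (snd x) v) - F v \<partial>P\<bar> \<le> (2 * C) * (C / (real k)\<^sup>2)"
        using F_bound_nonneg by (intro mult_mono diff) auto
      then show ?thesis unfolding eq by (simp add: abs_mult power2_eq_square)
    qed
    have "AE y in PY. snd (from_nat y :: nat list \<times> nat list) \<in> perms k"
      unfolding PY_def using AE_chain_perms k(1) by (subst AE_distr_iff) (auto simp: Y_def)
    then have ae: "AE y in PY. \<bar>\<integral>x. h y x \<partial>PX\<bar> \<le> 2 * C\<^sup>2 / (real k)\<^sup>2"
      by eventually_elim (rule inner)
    have "\<bar>\<integral>y. (\<integral>x. h y x \<partial>PX) \<partial>PY\<bar> \<le> (\<integral>y. \<bar>\<integral>x. h y x \<partial>PX\<bar> \<partial>PY)" by (rule integral_abs_bound)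
    also have "\<dots> \<le> (\<integral>y. 2 * C\<^sup>2 / (real k)\<^sup>2 \<partial>PY)"
      using integrable_fst'[OF hi] ae by (intro integral_mono_AE) auto
    finally show ?thesis .
  qed
  finally show ?thesis using PY.prob_space by simp
qed

text \<open>Each step adds twice a cross term and the second moment of an increment, together
at most \<open>5 C\<^sup>2/n\<^sup>2\<close>.\<close>

lemma second_moment:
  assumes "1 \<le> n"
  shows "(\<integral>\<omega>. (F (chain (n + d) \<omega>) - F (chain n \<omega>))\<^sup>2 \<partial>M) \<le> 5 * C\<^sup>2 * real d / (real n)\<^sup>2"
proof (induction d)
  case (Suc d)
  define A where "A \<omega> = F (chain (n + d) \<omega>) - F (chain n \<omega>)" for \<omega>
  define D where "D \<omega> = F (chain (Suc (n + d)) \<omega>) - F (chain (n + d) \<omega>)" for \<omega>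
  have [measurable]: "A \<in> borel_measurable M" "D \<in> borel_measurable M" unfolding A_def D_def by measurable
  have diff: "\<bar>F v - F u\<bar> \<le> 2 * C" for u v using F_bound[of u] F_bound[of v] by linarith
  have b: "\<bar>A \<omega>\<bar> \<le> 2 * C" "\<bar>D \<omega>\<bar> \<le> 2 * C" for \<omega> unfolding A_def D_def by (rule diff)+
  have bm: "\<bar>x * y\<bar> \<le> (2 * C) * (2 * C)" if "\<bar>x\<bar> \<le> 2 * C" "\<bar>y\<bar> \<le> 2 * C" for x y
    unfolding abs_mult using that by (intro mult_mono) auto
  have i: "integrable M (\<lambda>\<omega>. A \<omega> * A \<omega>)" "integrable M (\<lambda>\<omega>. A \<omega> * D \<omega>)" "integrable M (\<lambda>\<omega>. D \<omega> * D \<omega>)"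
    by (rule integrable_bounded[where B = "(2 * C) * (2 * C)"], measurable, intro bm b)+
  have "(\<integral>\<omega>. (F (chain (n + Suc d) \<omega>) - F (chain n \<omega>))\<^sup>2 \<partial>M) = (\<integral>\<omega>. A \<omega> * A \<omega> + 2 * (A \<omega> * D \<omega>) + D \<omega> * D \<omega> \<partial>M)"
    by (rule Bochner_Integration.integral_cong) (auto simp: A_def D_def power2_eq_square algebra_simps)
  also have "\<dots> = (\<integral>\<omega>. A \<omega> * A \<omega> \<partial>M) + 2 * (\<integral>\<omega>. A \<omega> * D \<omega> \<partial>M) + (\<integral>\<omega>. D \<omega> * D \<omega> \<partial>M)"
    using i by simp
  finally have eq: "(\<integral>\<omega>. (F (chain (n + Suc d) \<omega>) - F (chain n \<omega>))\<^sup>2 \<partial>M) = 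
     (\<integral>\<omega>. A \<omega> * A \<omega> \<partial>M) + 2 * (\<integral>\<omega>. A \<omega> * D \<omega> \<partial>M) + (\<integral>\<omega>. D \<omega> * D \<omega> \<partial>M)" .
  have 1: "(\<integral>\<omega>. A \<omega> * A \<omega> \<partial>M) \<le> 5 * C\<^sup>2 * real d / (real n)\<^sup>2"
    using Suc by (simp add: A_def power2_eq_square)
  have le: "(real n)\<^sup>2 \<le> (real (n + d))\<^sup>2" by (intro power_mono) auto
  have "\<bar>\<integral>\<omega>. A \<omega> * D \<omega> \<partial>M\<bar> \<le> 2 * C\<^sup>2 / (real (n + d))\<^sup>2"
    unfolding A_def D_def by (rule cross_term) (use assms in auto)
  also have "\<dots> \<le> 2 * C\<^sup>2 / (real n)\<^sup>2"
    using le assms by (intro divide_left_mono) auto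
  finally have 2: "\<bar>\<integral>\<omega>. A \<omega> * D \<omega> \<partial>M\<bar> \<le> 2 * C\<^sup>2 / (real n)\<^sup>2" .
  have "AE \<omega> in M. D \<omega> * D \<omega> \<le> C\<^sup>2 / (real n)\<^sup>2"
    using AE_step
  proof eventually_elim
    case (elim \<omega>)
    have "\<bar>D \<omega>\<bar> \<le> C / real (n + d)" using elim[rule_format, of "n + d"] assms unfolding D_def by simp
    also have "\<dots> \<le> C / real n" using assms F_bound_nonneg by (intro divide_left_mono) auto
    finally have "\<bar>D \<omega>\<bar>\<^sup>2 \<le> (C / real n)\<^sup>2" by (intro power_mono) auto
    then show ?case by (simp add: power_divide power2_eq_square)
  qed
  then have "(\<integral>\<omega>. D \<omega> * D \<omega> \<partial>M) \<le> (\<integral>\<omega>. C\<^sup>2 / (real n)\<^sup>2 \<partial>M)"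
    using i by (intro integral_mono_AE) auto
  then have 3: "(\<integral>\<omega>. D \<omega> * D \<omega> \<partial>M) \<le> C\<^sup>2 / (real n)\<^sup>2" by (simp add: prob_space)
  have "5 * C\<^sup>2 * real (Suc d) / (real n)\<^sup>2 = 5 * C\<^sup>2 * real d / (real n)\<^sup>2 + 2 * (2 * C\<^sup>2 / (real n)\<^sup>2) + C\<^sup>2 / (real n)\<^sup>2"
    by (simp add: algebra_simps add_divide_distrib)
  then show ?case using 1 2 3 unfolding eq by linarith
qed simp

text \<open>There are at most \<open>7 k\<^sup>2\<close> steps between the cubes, so the second moment is \<open>O(k\<^sup>2/k\<^sup>6)\<close>. The
elementary inequality \<open>2 \<bar>a\<bar> \<le> k\<^sup>2 a\<^sup>2 + 1/k\<^sup>2\<close> turns this into a first moment of order \<open>1/k\<^sup>2\<close>.\<close>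

lemma cube_increment:
  assumes "1 \<le> k"
  shows "(\<integral>\<^sup>+\<omega>. ennreal \<bar>F (chain (Suc k ^ 3) \<omega>) - F (chain (k ^ 3) \<omega>)\<bar> \<partial>M) \<le> ennreal ((18 * C\<^sup>2 + 1) * (1 / (real k)\<^sup>2))"
proof -
  define A where "A \<omega> = F (chain (Suc k ^ 3) \<omega>) - F (chain (k ^ 3) \<omega>)" for \<omega>
  have [measurable]: "A \<in> borel_measurable M" unfolding A_def by measurable
  have b: "\<bar>A \<omega>\<bar> \<le> 2 * C" for \<omega> unfolding A_def using F_bound[of "chain (Suc k ^ 3) \<omega>"] F_bound[of "chain (k ^ 3) \<omega>"] by linarith
  have bm: "\<bar>A \<omega> * A \<omega>\<bar> \<le> (2 * C) * (2 * C)" for \<omega>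
    unfolding abs_mult using b F_bound_nonneg by (intro mult_mono) auto
  have i: "integrable M (\<lambda>\<omega>. \<bar>A \<omega>\<bar>)" "integrable M (\<lambda>\<omega>. A \<omega> * A \<omega>)"
    by (rule integrable_bounded[where B = "2 * C"], measurable, simp add: b)
      (rule integrable_bounded[where B = "(2 * C) * (2 * C)"], measurable, rule bm)
  have "k ^ 3 \<le> Suc k ^ 3" by (rule power_mono) auto
  then obtain d where d: "Suc k ^ 3 = k ^ 3 + d" using le_Suc_ex by blast
  have d7: "d \<le> 7 * k ^ 2" using cube_gap[OF assms] d by linarith
  then have "real d \<le> real (7 * k ^ 2)" by (rule of_nat_mono)
  then have d7': "real d \<le> 7 * (real k)\<^sup>2" by simp
  have kp: "0 < real k" using assms by simp
  have "(\<integral>\<omega>. (A \<omega>)\<^sup>2 \<partial>M) \<le> 5 * C\<^sup>2 * real d / (real (k ^ 3))\<^sup>2"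
    unfolding A_def d by (rule second_moment) (use assms in simp)
  also have "\<dots> \<le> 5 * C\<^sup>2 * (7 * (real k)\<^sup>2) / (real (k ^ 3))\<^sup>2"
    using d7' by (intro divide_right_mono mult_left_mono) auto
  also have "\<dots> = 35 * C\<^sup>2 / (real k) ^ 4" using kp by (simp add: field_simps eval_nat_numeral)
  finally have m: "(\<integral>\<omega>. A \<omega> * A \<omega> \<partial>M) \<le> 35 * C\<^sup>2 / (real k) ^ 4" by (simp add: power2_eq_square)
  have amgm: "\<bar>a\<bar> \<le> ((real k)\<^sup>2 * (a * a) + 1 / (real k)\<^sup>2) / 2" for a :: real
  proof -
    have "0 \<le> (real k * \<bar>a\<bar> - 1 / real k)\<^sup>2" by simp
    also have "\<dots> = (real k)\<^sup>2 * (a * a) + 1 / (real k)\<^sup>2 - 2 * \<bar>a\<bar>"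
      using kp by (simp add: power2_diff power_mult_distrib power_divide) (simp add: power2_eq_square)
    finally show ?thesis by simp
  qed
  have "(\<integral>\<omega>. \<bar>A \<omega>\<bar> \<partial>M) \<le> (\<integral>\<omega>. ((real k)\<^sup>2 * (A \<omega> * A \<omega>) + 1 / (real k)\<^sup>2) / 2 \<partial>M)"
    using i by (intro integral_mono amgm) auto
  also have "\<dots> = ((real k)\<^sup>2 * (\<integral>\<omega>. A \<omega> * A \<omega> \<partial>M) + 1 / (real k)\<^sup>2) / 2"
    using i by (simp add: prob_space)
  also have "\<dots> \<le> ((real k)\<^sup>2 * (35 * C\<^sup>2 / (real k) ^ 4) + 1 / (real k)\<^sup>2) / 2"
    using m by (intro divide_right_mono add_right_mono mult_left_mono) auto
  also have "(real k)\<^sup>2 * (35 * C\<^sup>2 / (real k) ^ 4) = 35 * C\<^sup>2 * (1 / (real k)\<^sup>2)"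
    using kp by (simp add: eval_nat_numeral)
  also have "(35 * C\<^sup>2 * (1 / (real k)\<^sup>2) + 1 / (real k)\<^sup>2) / 2 \<le> (18 * C\<^sup>2 + 1) * (1 / (real k)\<^sup>2)"
  proof -
    have key: "(35 * c * y + y) / 2 \<le> (18 * c + 1) * y" if "0 \<le> c" "0 \<le> y" for c y :: real
      using mult_nonneg_nonneg[OF that] that by (simp add: algebra_simps)
    show ?thesis by (rule key) auto
  qed
  finally have "(\<integral>\<omega>. \<bar>A \<omega>\<bar> \<partial>M) \<le> (18 * C\<^sup>2 + 1) * (1 / (real k)\<^sup>2)" .
  moreover have "(\<integral>\<^sup>+\<omega>. ennreal \<bar>A \<omega>\<bar> \<partial>M) = ennreal (\<integral>\<omega>. \<bar>A \<omega>\<bar> \<partial>M)"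
    using i by (intro nn_integral_eq_integral) auto
  ultimately show ?thesis unfolding A_def by (simp add: ennreal_leI)
qed

text \<open>By monotone convergence the sum of the absolute increments along the cubes has finite mean, so it is
almost surely finite.\<close>

theorem AE_convergent: "AE \<omega> in M. convergent (\<lambda>n. F (chain n \<omega>))"
proof -
  define d where "d k \<omega> = \<bar>F (chain (Suc (Suc k) ^ 3) \<omega>) - F (chain (Suc k ^ 3) \<omega>)\<bar>" for k \<omega>
  have [measurable]: "d k \<in> borel_measurable M" for k unfolding d_def by measurable
  have s: "summable (\<lambda>k. (18 * C\<^sup>2 + 1) * (1 / (real (Suc k))\<^sup>2))"
    using inverse_power_summable[of 2, where 'a = real] 
    by (intro summable_mult) (subst summable_Suc_iff, simp add: inverse_eq_divide power_one_over)
  have "(\<integral>\<^sup>+\<omega>. (\<Sum>k. ennreal (d k \<omega>)) \<partial>M) = (\<Sum>k. \<integral>\<^sup>+\<omega>. ennreal (d k \<omega>) \<partial>M)"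
    by (rule nn_integral_suminf) measurable
  also have "\<dots> \<le> (\<Sum>k. ennreal ((18 * C\<^sup>2 + 1) * (1 / (real (Suc k))\<^sup>2)))"
    unfolding d_def by (intro suminf_le cube_increment) auto
  also have "\<dots> = ennreal (\<Sum>k. (18 * C\<^sup>2 + 1) * (1 / (real (Suc k))\<^sup>2))"
    using s by (intro suminf_ennreal2) auto
  finally have "(\<integral>\<^sup>+\<omega>. (\<Sum>k. ennreal (d k \<omega>)) \<partial>M) \<noteq> \<infinity>"
    by (auto simp: top_unique)
  then have "AE \<omega> in M. (\<Sum>k. ennreal (d k \<omega>)) \<noteq> \<infinity>"
    by (intro nn_integral_PInf_AE) auto
  then show ?thesis using AE_step
  proof eventually_elim
    case (elim \<omega>)
    have "summable (\<lambda>k. d k \<omega>)"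
      using elim(1) by (intro summable_suminf_not_top) (auto simp: d_def)
    then show ?case unfolding d_def
      by (intro convergent_from_cubes[where C = C]) (use elim(2) F_bound_nonneg in auto)
  qed
qed

end

end

context growth_driver
begin

lemma AE_convergent_graph_avg:
  assumes "second_order f"
  shows "AE \<omega> in M. convergent (\<lambda>n. graph_avg f (chain n \<omega>))"
proof -
  obtain gx gy C where b: "second_order_bound f gx gy C" using assms unfolding second_order_def by blast
  have C: "0 \<le> C" by (rule second_order_bound_nonneg[OF b])
  \<comment> \<open>cut off outside permutations, where the points could leave the square and the average be unbounded\<close>
  define F where "F w = (if w \<in> perms (length w) then graph_avg f w else 0)" for w
  have F: "F w = graph_avg f w" if "w \<in> perms n" for w n
    using that perms_length[OF that] by (simp add: F_def)
  have "AE \<omega> in M. convergent (\<lambda>n. F (chain n \<omega>))"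
  proof (rule AE_convergent[where C = "14 * C"])
    show "\<bar>F w\<bar> \<le> 14 * C" for w
    proof (cases "w \<in> perms (length w) \<and> w \<noteq> []")
      case True
      then have "\<bar>graph_avg f w\<bar> \<le> C" by (intro graph_avg_abs_le[OF b]) auto
      then show ?thesis using True C by (simp add: F_def)
    next
      case False then show ?thesis using C by (auto simp: F_def graph_avg_def)
    qed
  next
    fix n w j b' assume n: "1 \<le> n" and w: "w \<in> perms n" and j: "j \<in> {1..n}"
    obtain k where k: "k < n" "j = w ! k"
      using w j unfolding perms_def by (metis (mono_tags, lifting) in_set_conv_nth mem_Collect_eq)
    have "\<bar>graph_avg f (grow j b' w) - graph_avg f w\<bar> \<le> 14 * C / real (Suc n)"
      unfolding k(2) by (rule grow_step_bound[OF b w]) (use n k in auto)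
    also have "\<dots> \<le> 14 * C / real n" using n C by (intro divide_left_mono) auto
    finally show "\<bar>F (grow j b' w) - F w\<bar> \<le> 14 * C / real n"
      using F[OF w] F[OF grow_perms[OF w j]] by simp
  next
    fix n w b' assume n: "1 \<le> n" and w: "w \<in> perms n"
    have "(\<Sum>j=1..n. F (grow j b' w) - F w) = (\<Sum>j=1..n. graph_avg f (grow j b' w) - graph_avg f w)"
      by (intro sum.cong refl) (simp only: F[OF w] F[OF grow_perms[OF w]])
    then have "\<bar>(\<Sum>j=1..n. F (grow j b' w) - F w) / real n\<bar> \<le> 12 * C / (real (Suc n))\<^sup>2"
      using grow_step_drift[OF b w, of b'] n by simp
    also have "\<dots> \<le> 14 * C / (real n)\<^sup>2"
      using n C by (intro frac_le power_mono) auto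
    finally show "\<bar>(\<Sum>j=1..n. F (grow j b' w) - F w) / real n\<bar> \<le> 14 * C / (real n)\<^sup>2" .
  qed
  then show ?thesis using AE_chain_perms
  proof eventually_elim
    case (elim \<omega>)
    have "\<forall>\<^sub>F n in sequentially. F (chain n \<omega>) = graph_avg f (chain n \<omega>)"
      by (rule eventually_sequentiallyI[of 1]) (use elim(2) F in blast)
    then have "convergent (\<lambda>n. F (chain n \<omega>)) = convergent (\<lambda>n. graph_avg f (chain n \<omega>))" by (rule convergent_cong)
    then show ?case using elim(1) by simp
  qed
qed

end

section \<open>The permuton of a permutation\<close>

lemma sets_square: "sets (restrict_space lborel unit_square) = sets (restrict_space borel unit_square)"
  by (rule sets_restrict_space_cong) simp

lemma unit_square_borel [measurable]: "unit_square \<in> sets borel"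
  by (intro borel_closed closed_Times) auto

lemma emeasure_lborel_Times:
  fixes X Y :: "real set"
  assumes "X \<in> sets borel" "Y \<in> sets borel"
  shows "emeasure lborel (X \<times> Y) = emeasure lborel X * emeasure lborel Y"
  unfolding lborel_prod[symmetric] using assms by (intro lborel.emeasure_pair_measure_Times) auto

lemma cell_borel [measurable]: "cell n i k \<in> sets borel"
  unfolding cell_def by (intro borel_closed closed_Times) auto

lemma interval_length:
  assumes "1 \<le> n" "1 \<le> i"
  shows "emeasure lborel {(real i - 1) / real n..real i / real n} = ennreal (1 / real n)"
  using assms by (subst emeasure_lborel_Icc) (auto simp: divide_right_mono simp flip: diff_divide_distrib)

lemma emeasure_cell:
  assumes "1 \<le> n" "1 \<le> i" "1 \<le> k"
  shows "emeasure lborel (cell n i k) = ennreal (1 / (real n)\<^sup>2)"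
  unfolding cell_def using assms
  by (subst emeasure_lborel_Times) (auto simp: interval_length power2_eq_square simp flip: ennreal_mult)

lemma cell_subset:
  assumes "1 \<le> i" "i \<le> n" "1 \<le> k" "k \<le> n"
  shows "cell n i k \<subseteq> unit_square"
proof -
  have *: "0 \<le> (real i - 1) / real n" "real i / real n \<le> 1" if "1 \<le> i" "i \<le> n" for i
    using that by (auto simp: divide_le_eq)
  show ?thesis unfolding cell_def using *[OF assms(1,2)] *[OF assms(3,4)] by (intro Sigma_mono) auto
qed

lemma prob_space_unit_interval: "prob_space (restrict_space lborel {0..1::real})"
  by (rule prob_spaceI) (simp add: space_restrict_space emeasure_restrict_space)

text \<open>Consecutive intervals share an end point, which is a null set.\<close>

lemma sum_interval_pieces:
  assumes n: "1 \<le> n" and B [measurable]: "B \<in> sets borel" and B01: "B \<subseteq> {0..1}"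
  shows "(\<Sum>i=1..n. emeasure lborel ({(real i - 1) / real n..real i / real n} \<inter> B)) = emeasure lborel B"
proof -
  have "(\<Sum>i=1..m. emeasure lborel ({(real i - 1) / real n..real i / real n} \<inter> B)) = emeasure lborel ({0..real m / real n} \<inter> B)" for m
  proof (induction m)
    case 0
    have "emeasure lborel ({0..real 0 / real n} \<inter> B) \<le> emeasure lborel {0::real}" by (intro emeasure_mono) auto
    then show ?case by simp
  next
    case (Suc m)
    define a b where "a = real m / real n" and "b = real (Suc m) / real n"
    have ab: "0 \<le> a" "a \<le> b" unfolding a_def b_def by (auto intro: divide_right_mono)
    have "AE x in lborel. x \<noteq> a" by (rule AE_lborel_singleton)
    then have "emeasure lborel ({a..b} \<inter> B) = emeasure lborel ({a<..b} \<inter> B)"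
      by (intro emeasure_eq_AE) auto
    moreover have "emeasure lborel ({0..a} \<inter> B) + emeasure lborel ({a<..b} \<inter> B) = emeasure lborel (({0..a} \<inter> B) \<union> ({a<..b} \<inter> B))"
      by (rule plus_emeasure) auto
    moreover have "({0..a} \<inter> B) \<union> ({a<..b} \<inter> B) = {0..b} \<inter> B" using ab by auto
    ultimately show ?case using Suc by (simp add: a_def b_def)
  qed
  from this[of n] show ?thesis using n B01 by (simp add: Int_absorb1)
qed

context
  fixes w :: "nat list" and n :: nat
  assumes w: "w \<in> perms n" and n: "1 \<le> n"
begin

definition cell_of :: "nat \<Rightarrow> (real \<times> real) set" where
  "cell_of i = cell n i (w ! (i - 1))"

text \<open>Each of the \<open>n\<close> cells has area \<open>1/n\<^sup>2\<close> and carries mass \<open>1/n\<close>, hence density \<open>n\<close>.\<close>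

definition square_density :: "real \<times> real \<Rightarrow> real" where
  "square_density z = real n * (\<Sum>i=1..n. indicator (cell_of i) z)"

lemma entry_bounds: "i \<in> {1..n} \<Longrightarrow> 1 \<le> w ! (i - 1) \<and> w ! (i - 1) \<le> n"
  using perms_nth[OF w, of "i - 1"] by auto

lemma cell_of_subset: "i \<in> {1..n} \<Longrightarrow> cell_of i \<subseteq> unit_square"
  unfolding cell_of_def using entry_bounds by (intro cell_subset) auto

lemma cell_of_borel [measurable]: "cell_of i \<in> sets borel"
  by (simp add: cell_of_def)

lemma emeasure_cell_of: "i \<in> {1..n} \<Longrightarrow> emeasure lborel (cell_of i) = ennreal (1 / (real n)\<^sup>2)"
  unfolding cell_of_def using entry_bounds n by (intro emeasure_cell) auto

lemma square_density_measurable [measurable]: "square_density \<in> borel_measurable borel"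
  unfolding square_density_def by measurable

lemma square_density_nonneg: "0 \<le> square_density z"
  unfolding square_density_def by (intro mult_nonneg_nonneg sum_nonneg) auto

lemma nn_integral_square_density:
  assumes A: "A \<in> sets (restrict_space borel unit_square)"
  shows "(\<integral>\<^sup>+z. ennreal (square_density z) * indicator A z \<partial>restrict_space lborel unit_square)
    = ennreal (real n) * (\<Sum>i=1..n. emeasure lborel (cell_of i \<inter> A))"
proof -
  have Ab[measurable]: "A \<in> sets borel" and As: "A \<subseteq> unit_square"
    using A by (auto simp: sets_restrict_space_iff)
  have "(\<integral>\<^sup>+z. ennreal (square_density z) * indicator A z \<partial>restrict_space lborel unit_square)
      = (\<integral>\<^sup>+z. ennreal (square_density z) * indicator A z * indicator unit_square z \<partial>lborel)"
    by (rule nn_integral_restrict_space) simp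
  also have "\<dots> = (\<integral>\<^sup>+z. (\<Sum>i=1..n. ennreal (real n) * indicator (cell_of i \<inter> A) z) \<partial>lborel)"
  proof (rule nn_integral_cong)
    fix z :: "real \<times> real"
    show "ennreal (square_density z) * indicator A z * indicator unit_square z = (\<Sum>i=1..n. ennreal (real n) * indicator (cell_of i \<inter> A) z)"
    proof (cases "z \<in> A")
      case True
      then have "z \<in> unit_square" using As by auto
      have "ennreal (square_density z) = ennreal (real n) * (\<Sum>i=1..n. ennreal (indicator (cell_of i) z))"
        unfolding square_density_def by (simp add: ennreal_mult sum_nonneg sum_ennreal)
      also have "\<dots> = (\<Sum>i=1..n. ennreal (real n) * indicator (cell_of i \<inter> A) z)"
        using True by (simp add: sum_distrib_left indicator_inter_arith ennreal_indicator)
      finally show ?thesis using True \<open>z \<in> unit_square\<close> by simp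
    qed simp
  qed
  also have "\<dots> = (\<Sum>i=1..n. \<integral>\<^sup>+z. ennreal (real n) * indicator (cell_of i \<inter> A) z \<partial>lborel)"
    by (rule nn_integral_sum) measurable
  also have "\<dots> = (\<Sum>i=1..n. ennreal (real n) * emeasure lborel (cell_of i \<inter> A))"
    by (intro sum.cong refl nn_integral_cmult_indicator) measurable
  finally show ?thesis by (simp add: sum_distrib_left)
qed

text \<open>Writing the explicitly given set function as a density with respect to Lebesgue measure yields
countable additivity and the formulas for integrals at once.\<close>

lemma permuton_of_eq_density:
  "permuton_of w = density (restrict_space lborel unit_square) (\<lambda>z. ennreal (square_density z))"
proof -
  have "permuton_of w = measure_of unit_square (sets (restrict_space borel unit_square))
       (\<lambda>A. (\<Sum>i=1..n. emeasure (uniform_measure lborel (cell_of i)) A) / of_nat n)"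
    unfolding permuton_of_def Let_def perms_length[OF w] cell_of_def ..
  also have "\<dots> = measure_of unit_square (sets (restrict_space borel unit_square))
       (\<lambda>A. \<integral>\<^sup>+z. ennreal (square_density z) * indicator A z \<partial>restrict_space lborel unit_square)"
  proof (rule measure_of_eq)
    show "sets (restrict_space borel unit_square) \<subseteq> Pow unit_square"
      using sets.space_closed[of "restrict_space borel unit_square"] by (simp add: space_restrict_space)
    fix A assume "A \<in> sigma_sets unit_square (sets (restrict_space borel unit_square))"
    then have A: "A \<in> sets (restrict_space borel unit_square)"
      using sets.sigma_sets_eq[of "restrict_space borel unit_square"] by (simp add: space_restrict_space)
    have Ab[measurable]: "A \<in> sets borel" using A by (auto simp: sets_restrict_space_iff)
    have "(\<Sum>i=1..n. emeasure (uniform_measure lborel (cell_of i)) A) / of_nat n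
       = (\<Sum>i=1..n. emeasure (uniform_measure lborel (cell_of i)) A / of_nat n)"
      by (simp add: divide_ennreal_def sum_distrib_right)
    also have "\<dots> = (\<Sum>i=1..n. ennreal (real n) * emeasure lborel (cell_of i \<inter> A))"
    proof (rule sum.cong[OF refl])
      fix i assume i: "i \<in> {1..n}"
      have np: "0 < real n" using n by simp
      have "emeasure (uniform_measure lborel (cell_of i)) A / of_nat n
        = emeasure lborel (cell_of i \<inter> A) * (inverse (ennreal (1 / (real n)\<^sup>2)) * inverse (ennreal (real n)))"
        by (simp add: emeasure_uniform_measure emeasure_cell_of[OF i] divide_ennreal_def mult.assoc ennreal_of_nat_eq_real_of_nat)
      also have "inverse (ennreal (1 / (real n)\<^sup>2)) * inverse (ennreal (real n)) = ennreal (real n)"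
        using np by (simp add: inverse_ennreal power2_eq_square flip: ennreal_mult)
      finally show "emeasure (uniform_measure lborel (cell_of i)) A / of_nat n = ennreal (real n) * emeasure lborel (cell_of i \<inter> A)"
        by (simp add: mult.commute)
    qed
    also have "\<dots> = (\<integral>\<^sup>+z. ennreal (square_density z) * indicator A z \<partial>restrict_space lborel unit_square)"
      by (simp add: nn_integral_square_density[OF A] sum_distrib_left)
    finally show "(\<Sum>i=1..n. emeasure (uniform_measure lborel (cell_of i)) A) / of_nat n = \<dots>" .
  qed
  also have "\<dots> = density (restrict_space lborel unit_square) (\<lambda>z. ennreal (square_density z))"
    by (simp add: density_def space_restrict_space sets_square)
  finally show ?thesis .
qed

lemma sets_permuton_of: "sets (permuton_of w) = sets (restrict_space borel unit_square)"
  by (simp add: permuton_of_eq_density sets_square)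

lemma space_permuton_of: "space (permuton_of w) = unit_square"
  by (simp add: permuton_of_eq_density space_restrict_space)

lemma emeasure_permuton_of:
  assumes "A \<in> sets (restrict_space borel unit_square)"
  shows "emeasure (permuton_of w) A = ennreal (real n) * (\<Sum>i=1..n. emeasure lborel (cell_of i \<inter> A))"
proof -
  have [measurable]: "(\<lambda>z. ennreal (square_density z)) \<in> borel_measurable (restrict_space lborel unit_square)"
    by (rule measurable_restrict_space1) simp
  show ?thesis unfolding permuton_of_eq_density
    using assms by (subst emeasure_density) (auto simp: nn_integral_square_density sets_square)
qed

lemma fst_square_measurable: "fst \<in> restrict_space borel unit_square \<rightarrow>\<^sub>M restrict_space borel {0..1::real}"
  by (intro measurable_restrict_space3 borel_measurable_continuous_onI continuous_on_fst continuous_on_id) auto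

lemma snd_square_measurable: "snd \<in> restrict_space borel unit_square \<rightarrow>\<^sub>M restrict_space borel {0..1::real}"
  by (intro measurable_restrict_space3 borel_measurable_continuous_onI continuous_on_snd continuous_on_id) auto

text \<open>The part of a cell over a set \<open>B\<close> of abscissae is a rectangle of height \<open>1/n\<close>, and each column contains
one cell.\<close>

lemma permuton_of_fst:
  "distr (permuton_of w) (restrict_space borel {0..1}) fst = restrict_space lborel {0..1}"
proof (rule measure_eqI)
  show "sets (distr (permuton_of w) (restrict_space borel {0..1}) fst) = sets (restrict_space lborel {0..1::real})"
    by (simp cong: sets_restrict_space_cong)
  fix B assume "B \<in> sets (distr (permuton_of w) (restrict_space borel {0..1}) fst)"
  then have B': "B \<in> sets (restrict_space borel {0..1::real})" by simp
  then have B: "B \<in> sets borel" "B \<subseteq> {0..1}" by (auto simp: sets_restrict_space_iff)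
  have m: "fst \<in> permuton_of w \<rightarrow>\<^sub>M restrict_space borel {0..1::real}"
    using fst_square_measurable by (simp cong: measurable_cong_sets add: sets_permuton_of)
  have pre: "fst -` B \<inter> space (permuton_of w) = B \<times> {0..1}" using B by (auto simp: space_permuton_of)
  have A: "B \<times> {0..1} \<in> sets (restrict_space borel unit_square)"
    using measurable_sets[OF m B'] by (simp add: pre sets_permuton_of)
  have "emeasure (distr (permuton_of w) (restrict_space borel {0..1}) fst) B = emeasure (permuton_of w) (B \<times> {0..1})"
    using emeasure_distr[OF m B'] by (simp add: pre)
  also have "\<dots> = ennreal (real n) * (\<Sum>i=1..n. emeasure lborel (cell_of i \<inter> (B \<times> {0..1})))"
    by (rule emeasure_permuton_of[OF A])
  also have "(\<Sum>i=1..n. emeasure lborel (cell_of i \<inter> (B \<times> {0..1}))) =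
     (\<Sum>i=1..n. emeasure lborel ({(real i - 1) / real n..real i / real n} \<inter> B) * ennreal (1 / real n))"
  proof (rule sum.cong[OF refl])
    fix i assume i: "i \<in> {1..n}"
    have "cell_of i \<inter> (B \<times> {0..1}) = ({(real i - 1) / real n..real i / real n} \<inter> B) \<times> {(real (w ! (i - 1)) - 1) / real n..real (w ! (i - 1)) / real n}"
      using cell_of_subset[OF i] by (auto simp: cell_of_def cell_def)
    then show "emeasure lborel (cell_of i \<inter> (B \<times> {0..1})) = emeasure lborel ({(real i - 1) / real n..real i / real n} \<inter> B) * ennreal (1 / real n)"
      using B entry_bounds[OF i] n by (simp add: emeasure_lborel_Times interval_length)
  qed
  also have "\<dots> = emeasure lborel B * ennreal (1 / real n)"
    by (subst sum_distrib_right[symmetric]) (simp only: sum_interval_pieces[OF n B])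
  also have "ennreal (real n) * (emeasure lborel B * ennreal (1 / real n)) = emeasure lborel B * ennreal (real n * (1 / real n))"
    by (simp only: ennreal_mult' ennreal_mult mult_ac of_nat_0_le_iff)
  also have "\<dots> = emeasure lborel B" using n by simp
  also have "\<dots> = emeasure (restrict_space lborel {0..1}) B"
    using B by (simp add: emeasure_restrict_space)
  finally show "emeasure (distr (permuton_of w) (restrict_space borel {0..1}) fst) B = emeasure (restrict_space lborel {0..1}) B" .
qed

text \<open>As for the first marginal, since each row contains one cell by bijectivity.\<close>

lemma permuton_of_snd:
  "distr (permuton_of w) (restrict_space borel {0..1}) snd = restrict_space lborel {0..1}"
proof (rule measure_eqI)
  show "sets (distr (permuton_of w) (restrict_space borel {0..1}) snd) = sets (restrict_space lborel {0..1::real})"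
    by (simp cong: sets_restrict_space_cong)
  fix B assume "B \<in> sets (distr (permuton_of w) (restrict_space borel {0..1}) snd)"
  then have B': "B \<in> sets (restrict_space borel {0..1::real})" by simp
  then have B: "B \<in> sets borel" "B \<subseteq> {0..1}" by (auto simp: sets_restrict_space_iff)
  have m: "snd \<in> permuton_of w \<rightarrow>\<^sub>M restrict_space borel {0..1::real}"
    using snd_square_measurable by (simp cong: measurable_cong_sets add: sets_permuton_of)
  have pre: "snd -` B \<inter> space (permuton_of w) = {0..1} \<times> B" using B by (auto simp: space_permuton_of)
  have A: "{0..1} \<times> B \<in> sets (restrict_space borel unit_square)"
    using measurable_sets[OF m B'] by (simp add: pre sets_permuton_of)
  define p where "p k = emeasure lborel ({(real k - 1) / real n..real k / real n} \<inter> B)" for k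
  have "emeasure (distr (permuton_of w) (restrict_space borel {0..1}) snd) B = emeasure (permuton_of w) ({0..1} \<times> B)"
    using emeasure_distr[OF m B'] by (simp add: pre)
  also have "\<dots> = ennreal (real n) * (\<Sum>i=1..n. emeasure lborel (cell_of i \<inter> ({0..1} \<times> B)))"
    by (rule emeasure_permuton_of[OF A])
  also have "(\<Sum>i=1..n. emeasure lborel (cell_of i \<inter> ({0..1} \<times> B))) =
     (\<Sum>i=1..n. p (w ! (i - 1)) * ennreal (1 / real n))"
  proof (rule sum.cong[OF refl])
    fix i assume i: "i \<in> {1..n}"
    have "cell_of i \<inter> ({0..1} \<times> B) = {(real i - 1) / real n..real i / real n} \<times> ({(real (w ! (i - 1)) - 1) / real n..real (w ! (i - 1)) / real n} \<inter> B)"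
      using cell_of_subset[OF i] by (auto simp: cell_of_def cell_def)
    then show "emeasure lborel (cell_of i \<inter> ({0..1} \<times> B)) = p (w ! (i - 1)) * ennreal (1 / real n)"
      using B i n by (simp add: emeasure_lborel_Times interval_length p_def mult.commute)
  qed
  also have "\<dots> = (\<Sum>i=1..n. p (w ! (i - 1))) * ennreal (1 / real n)"
    by (rule sum_distrib_right[symmetric])
  also have "(\<Sum>i=1..n. p (w ! (i - 1))) = (\<Sum>i<n. p (w ! i))"
    by (rule sum.reindex_bij_witness[of _ Suc "\<lambda>i. i - 1"]) auto
  also have "\<dots> = (\<Sum>k=1..n. p k)" by (rule sum.reindex_bij_betw[OF perms_bij[OF w]])
  also have "\<dots> = emeasure lborel B" unfolding p_def by (rule sum_interval_pieces[OF n B])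
  also have "ennreal (real n) * (emeasure lborel B * ennreal (1 / real n)) = emeasure lborel B * ennreal (real n * (1 / real n))"
    by (simp only: ennreal_mult' ennreal_mult mult_ac of_nat_0_le_iff)
  also have "\<dots> = emeasure lborel B" using n by simp
  also have "\<dots> = emeasure (restrict_space lborel {0..1}) B"
    using B by (simp add: emeasure_restrict_space)
  finally show "emeasure (distr (permuton_of w) (restrict_space borel {0..1}) snd) B = emeasure (restrict_space lborel {0..1}) B" .
qed

lemma permuton_of_in_permutons: "permuton_of w \<in> permutons"
proof -
  have m: "fst \<in> permuton_of w \<rightarrow>\<^sub>M restrict_space borel {0..1::real}"
    using fst_square_measurable by (simp cong: measurable_cong_sets add: sets_permuton_of)
  have "prob_space (distr (permuton_of w) (restrict_space borel {0..1}) fst)"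
    using prob_space_unit_interval by (simp add: permuton_of_fst)
  then have "prob_space (permuton_of w)" by (rule prob_space_distrD[OF m])
  then show ?thesis unfolding permutons_def
    using sets_permuton_of permuton_of_fst permuton_of_snd by blast
qed

text \<open>On the cell of an entry, \<open>f\<close> differs from its value at the upper right corner by at most
\<open>4 C/n\<close>, and these corners are the points over which \<open>graph_avg\<close> averages.\<close>

lemma integral_permuton_of:
  assumes f: "second_order_bound f gx gy C" and fm [measurable]: "f \<in> borel_measurable borel"
  shows "\<bar>(\<integral>z. f z \<partial>permuton_of w) - graph_avg f w\<bar> \<le> 4 * C / real n"
proof -
  have np: "0 < real n" using n by simp
  define pt where "pt i = (real i / real n, real (w ! (i - 1)) / real n)" for i
  have pt: "pt i \<in> unit_square" "pt i \<in> cell_of i" if "i \<in> {1..n}" for i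
  proof -
    show "pt i \<in> cell_of i" by (auto simp: pt_def cell_of_def cell_def divide_right_mono)
    then show "pt i \<in> unit_square" using cell_of_subset[OF that] by auto
  qed
  have mcell: "measure lborel (cell_of i) = 1 / (real n)\<^sup>2" if "i \<in> {1..n}" for i
    using emeasure_cell_of[OF that] by (simp add: measure_def)
  have fin: "emeasure lborel (cell_of i) < \<infinity>" if "i \<in> {1..n}" for i
    using emeasure_cell_of[OF that] by simp
  have int1: "integrable lborel (\<lambda>z. indicator (cell_of i) z * c)" if "i \<in> {1..n}" for i and c :: real
    using fin[OF that] by (intro integrable_mult_left integrable_real_indicator) auto
  have int: "integrable lborel (\<lambda>z. indicator (cell_of i) z * f z)" if i: "i \<in> {1..n}" for i
  proof (rule Bochner_Integration.integrable_bound[OF int1[OF i, of C]])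
    show "AE z in lborel. norm (indicator (cell_of i) z * f z) \<le> norm (indicator (cell_of i) z * C)"
    proof (rule AE_I2)
      fix z show "norm (indicator (cell_of i) z * f z) \<le> norm (indicator (cell_of i) z * C)"
        using second_order_boundD(1)[OF f, of z] cell_of_subset[OF i] second_order_bound_nonneg[OF f]
        by (auto split: split_indicator)
    qed
  qed measurable
  have close: "\<bar>(\<integral>z. indicator (cell_of i) z * f z \<partial>lborel) - f (pt i) / (real n)\<^sup>2\<bar> \<le> (4 * C / real n) / (real n)\<^sup>2"
    if i: "i \<in> {1..n}" for i
  proof -
    have "(\<integral>z. indicator (cell_of i) z * f z \<partial>lborel) - f (pt i) / (real n)\<^sup>2
      = (\<integral>z. indicator (cell_of i) z * f z \<partial>lborel) - (\<integral>z. indicator (cell_of i) z * f (pt i) \<partial>lborel)"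
      by (simp add: mcell[OF i])
    also have "\<dots> = (\<integral>z. indicator (cell_of i) z * f z - indicator (cell_of i) z * f (pt i) \<partial>lborel)"
      by (rule Bochner_Integration.integral_diff[OF int[OF i] int1[OF i], symmetric])
    also have "\<bar>\<dots>\<bar> \<le> (\<integral>z. \<bar>indicator (cell_of i) z * f z - indicator (cell_of i) z * f (pt i)\<bar> \<partial>lborel)"
      by (rule integral_abs_bound)
    also have "\<dots> \<le> (\<integral>z. indicator (cell_of i) z * (4 * C / real n) \<partial>lborel)"
    proof (rule integral_mono)
      show "integrable lborel (\<lambda>z. \<bar>indicator (cell_of i) z * f z - indicator (cell_of i) z * f (pt i)\<bar>)"
        by (intro integrable_abs Bochner_Integration.integrable_diff int int1 i)
      show "integrable lborel (\<lambda>z. indicator (cell_of i) z * (4 * C / real n))" by (rule int1[OF i])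
      fix z
      show "\<bar>indicator (cell_of i) z * f z - indicator (cell_of i) z * f (pt i)\<bar> \<le> indicator (cell_of i) z * (4 * C / real n)"
      proof (cases "z \<in> cell_of i")
        case True
        then have zs: "z \<in> unit_square" using cell_of_subset[OF i] by auto
        have d: "\<bar>fst z - fst (pt i)\<bar> \<le> 1 / real n" "\<bar>snd z - snd (pt i)\<bar> \<le> 1 / real n"
          using True by (auto simp: cell_of_def cell_def pt_def diff_divide_distrib)
        have "\<bar>f z - f (pt i)\<bar> \<le> 2 * C * (\<bar>fst z - fst (pt i)\<bar> + \<bar>snd z - snd (pt i)\<bar>)"
          by (rule second_order_bound_lipschitz[OF f pt(1)[OF i] zs])
        also have "\<dots> \<le> 2 * C * (1 / real n + 1 / real n)"
          using second_order_bound_nonneg[OF f] by (intro mult_left_mono add_mono d) auto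
        finally show ?thesis using True by simp
      qed simp
    qed
    also have "\<dots> = (4 * C / real n) / (real n)\<^sup>2" by (simp add: mcell[OF i])
    finally show ?thesis .
  qed
  have "(\<integral>z. f z \<partial>permuton_of w) = (\<integral>z. square_density z *\<^sub>R f z \<partial>restrict_space lborel unit_square)"
    unfolding permuton_of_eq_density
    by (rule integral_density) (auto intro!: measurable_restrict_space1 simp: square_density_nonneg)
  also have "\<dots> = (\<integral>z. indicator unit_square z *\<^sub>R (square_density z *\<^sub>R f z) \<partial>lborel)"
    by (rule integral_restrict_space) simp
  also have "\<dots> = (\<integral>z. (\<Sum>i=1..n. real n * (indicator (cell_of i) z * f z)) \<partial>lborel)"
  proof (rule Bochner_Integration.integral_cong[OF refl])
    fix z
    show "indicator unit_square z *\<^sub>R (square_density z *\<^sub>R f z) = (\<Sum>i=1..n. real n * (indicator (cell_of i) z * f z))"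
      unfolding square_density_def real_scaleR_def sum_distrib_left sum_distrib_right
    proof (rule sum.cong[OF refl])
      fix i assume "i \<in> {1..n}"
      then show "indicator unit_square z * (real n * indicator (cell_of i) z * f z) = real n * (indicator (cell_of i) z * f z)"
        using cell_of_subset[of i] by (cases "z \<in> cell_of i") auto
    qed
  qed
  also have "\<dots> = (\<Sum>i=1..n. real n * (\<integral>z. indicator (cell_of i) z * f z \<partial>lborel))"
    using int by (subst Bochner_Integration.integral_sum) auto
  finally have eq: "(\<integral>z. f z \<partial>permuton_of w) = (\<Sum>i=1..n. real n * (\<integral>z. indicator (cell_of i) z * f z \<partial>lborel))" .
  have "graph_avg f w = (\<Sum>i<n. f (pt (Suc i))) / real n"
    unfolding graph_avg_def perms_length[OF w] pt_def by (simp add: add.commute)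
  also have "(\<Sum>i<n. f (pt (Suc i))) = (\<Sum>i=1..n. f (pt i))"
    by (rule sum.reindex_bij_witness[of _ "\<lambda>i. i - 1" Suc]) auto
  also have "\<dots> / real n = (\<Sum>i=1..n. real n * (f (pt i) / (real n)\<^sup>2))"
    using np by (simp add: sum_divide_distrib power2_eq_square)
  finally have "(\<integral>z. f z \<partial>permuton_of w) - graph_avg f w = (\<Sum>i=1..n. real n * ((\<integral>z. indicator (cell_of i) z * f z \<partial>lborel) - f (pt i) / (real n)\<^sup>2))"
    unfolding eq by (simp add: sum_subtractf right_diff_distrib)
  also have "\<bar>\<dots>\<bar> \<le> (\<Sum>i=1..n. real n * ((4 * C / real n) / (real n)\<^sup>2))"
    using np by (intro order_trans[OF sum_abs] sum_mono) (simp only: abs_mult abs_of_nat, intro mult_left_mono close, auto)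
  also have "\<dots> = 4 * C / real n" using np by (simp add: power2_eq_square)
  finally show ?thesis .
qed

end

section \<open>Coding the square on the line\<close>

lemma permutonsD:
  assumes "P \<in> permutons"
  shows "prob_space P" "sets P = sets (restrict_space borel unit_square)" "space P = unit_square"
    "distr P (restrict_space borel {0..1}) fst = restrict_space lborel {0..1}"
    "distr P (restrict_space borel {0..1}) snd = restrict_space lborel {0..1}"
proof -
  show *: "sets P = sets (restrict_space borel unit_square)" using assms by (simp add: permutons_def)
  show "space P = unit_square" using sets_eq_imp_space_eq[OF *] by (simp add: space_restrict_space)
qed (use assms in \<open>simp_all add: permutons_def\<close>)

text \<open>The digit with index \<open>0\<close> separates the end point \<open>1\<close> from \<open>0\<close>.\<close>

definition digit :: "nat \<Rightarrow> real \<Rightarrow> int" where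
  "digit k x = \<lfloor>2 ^ k * x\<rfloor> mod 2"

lemma digit_range: "digit k x \<in> {0, 1}" by (auto simp: digit_def)

lemma floor_double: "\<lfloor>2 * x\<rfloor> = 2 * \<lfloor>x\<rfloor> + \<lfloor>2 * x\<rfloor> mod 2" for x :: real
proof -
  have "\<lfloor>2 * x\<rfloor> div 2 = \<lfloor>x\<rfloor>"
    using floor_divide_real_eq_div[of 2 "2 * x"] by simp
  then show ?thesis using mult_div_mod_eq[of 2 "\<lfloor>2 * x\<rfloor>"] by simp
qed

lemma digits_determine_floor:
  assumes "x \<in> {0..1}" "y \<in> {0..1}" "\<And>k. k \<le> n \<Longrightarrow> digit k x = digit k y"
  shows "\<lfloor>2 ^ n * x\<rfloor> = \<lfloor>2 ^ n * y\<rfloor>"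
  using assms(3)
proof (induction n)
  case 0
  have "\<lfloor>z\<rfloor> mod 2 = \<lfloor>z\<rfloor>" if "z \<in> {0..1}" for z :: real
  proof -
    have "\<lfloor>z\<rfloor> \<ge> 0" "\<lfloor>z\<rfloor> < 2" using that by (auto simp: floor_less_iff)
    then show ?thesis by simp
  qed
  then show ?case using 0[of 0] assms(1,2) by (simp add: digit_def)
next
  case (Suc n)
  have "\<lfloor>2 ^ Suc n * z\<rfloor> = 2 * \<lfloor>2 ^ n * z\<rfloor> + digit (Suc n) z" for z
    using floor_double[of "2 ^ n * z"] by (simp add: digit_def mult.assoc)
  then show ?case using Suc.IH Suc.prems by simp
qed

lemma digits_determine:
  assumes "x \<in> {0..1}" "y \<in> {0..1}" "\<And>k. k \<le> n \<Longrightarrow> digit k x = digit k y"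
  shows "\<bar>x - y\<bar> < 1 / 2 ^ n"
proof -
  have "\<lfloor>2 ^ n * x\<rfloor> = \<lfloor>2 ^ n * y\<rfloor>" by (rule digits_determine_floor[OF assms])
  then have "\<bar>2 ^ n * x - 2 ^ n * y\<bar> < 1" by linarith
  then have "2 ^ n * \<bar>x - y\<bar> < 1" by (simp add: abs_mult flip: right_diff_distrib)
  then show ?thesis by (simp add: field_simps)
qed

text \<open>An injective code for points of the square. The pair of binary digits of index \<open>k\<close> is one digit
in \<open>{0..3}\<close> to base \<open>8\<close>. Since the base exceeds the number of digits, different digit
sequences stay apart: two codes can only be close if many digits agree, so that the inverse is
uniformly continuous, although the code itself is discontinuous.\<close>

definition interleave :: "real \<times> real \<Rightarrow> real" where
  "interleave z = (\<Sum>k. of_int (2 * digit k (fst z) + digit k (snd z)) / 8 ^ k)"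

lemma interleave_digit_range: "2 * digit k x + digit k y \<in> {0..3}"
  using digit_range[of k x] digit_range[of k y] by auto

lemma summable_digits:
  fixes a :: "nat \<Rightarrow> real"
  assumes "\<And>k. \<bar>a k\<bar> \<le> 3" shows "summable (\<lambda>k. a k / 8 ^ k)"
proof (rule summable_comparison_test)
  show "\<exists>N. \<forall>n\<ge>N. norm (a n / 8 ^ n) \<le> 3 * (1 / 8) ^ n"
    using assms by (auto simp: power_divide divide_right_mono)
  show "summable (\<lambda>n. 3 * (1 / 8 :: real) ^ n)" by (intro summable_mult summable_geometric) simp
qed

lemma suminf_digits_le:
  fixes a :: "nat \<Rightarrow> real"
  assumes "\<And>k. \<bar>a k\<bar> \<le> 3" shows "\<bar>\<Sum>k. a k / 8 ^ k\<bar> \<le> 24 / 7"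
proof -
  have "\<bar>\<Sum>k. a k / 8 ^ k\<bar> \<le> (\<Sum>k. 3 * (1 / 8) ^ k)"
  proof (rule norm_suminf_le[where 'a = real, unfolded real_norm_def])
    show "\<bar>a n / 8 ^ n\<bar> \<le> 3 * (1 / 8) ^ n" for n
      using assms[of n] by (simp add: power_divide divide_right_mono)
    show "summable (\<lambda>n. 3 * (1 / 8 :: real) ^ n)" by (intro summable_mult summable_geometric) simp
  qed
  also have "\<dots> = 24 / 7" by (subst suminf_mult) (auto simp: suminf_geometric intro: summable_geometric)
  finally show ?thesis .
qed

text \<open>The first nonzero term has absolute value at least \<open>1/8\<^sup>N\<close>, and the remaining ones
contribute at most \<open>3/7\<close> of that.\<close>

lemma first_difference_gap:
  fixes c :: "nat \<Rightarrow> real"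
  assumes c: "\<And>k. \<bar>c k\<bar> \<le> 3" and N: "\<And>k. k < N \<Longrightarrow> c k = 0" "1 \<le> \<bar>c N\<bar>"
  shows "1 / 2 / 8 ^ N \<le> \<bar>\<Sum>k. c k / 8 ^ k\<bar>"
proof -
  have "(\<Sum>k. c k / 8 ^ k) = (\<Sum>k. c (k + Suc N) / 8 ^ (k + Suc N)) + (\<Sum>k<Suc N. c k / 8 ^ k)"
    by (rule suminf_split_initial_segment[OF summable_digits[OF c]])
  also have "(\<Sum>k<Suc N. c k / 8 ^ k) = c N / 8 ^ N" using N by simp
  also have "(\<Sum>k. c (k + Suc N) / 8 ^ (k + Suc N)) = (\<Sum>k. (c (k + Suc N) / 8 ^ k) / 8 ^ Suc N)"
    by (simp add: power_add mult_ac)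
  also have "\<dots> = (\<Sum>k. c (k + Suc N) / 8 ^ k) / 8 ^ Suc N"
    by (rule suminf_divide[OF summable_digits[OF c]])
  finally have eq: "(\<Sum>k. c k / 8 ^ k) = ((\<Sum>k. c (k + Suc N) / 8 ^ k) / 8 + c N) / 8 ^ N"
    by (simp add: field_simps)
  have "\<bar>\<Sum>k. c (k + Suc N) / 8 ^ k\<bar> \<le> 24 / 7" by (rule suminf_digits_le[OF c])
  then have "1 / 2 \<le> \<bar>(\<Sum>k. c (k + Suc N) / 8 ^ k) / 8 + c N\<bar>" using N(2) by linarith
  then have "1 / 2 / 8 ^ N \<le> \<bar>(\<Sum>k. c (k + Suc N) / 8 ^ k) / 8 + c N\<bar> / 8 ^ N" by (rule divide_right_mono) simp
  then show ?thesis unfolding eq abs_divide by simp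
qed

lemma interleave_bounds: "\<bar>interleave z\<bar> \<le> 4"
proof -
  have "\<bar>of_int (2 * digit k (fst z) + digit k (snd z)) :: real\<bar> \<le> 3" for k
    using interleave_digit_range[of k "fst z" "snd z"] by auto
  then have "\<bar>interleave z\<bar> \<le> 24 / 7" unfolding interleave_def by (rule suminf_digits_le)
  then show ?thesis by simp
qed

lemma interleave_measurable [measurable]: "interleave \<in> borel_measurable borel"
proof -
  have [measurable]: "digit k \<in> borel \<rightarrow>\<^sub>M count_space UNIV" for k
    unfolding digit_def[abs_def] by measurable
  have [measurable]: "fst \<in> borel_measurable (borel :: (real \<times> real) measure)" "snd \<in> borel_measurable (borel :: (real \<times> real) measure)"
    by (auto intro!: borel_measurable_continuous_onI continuous_intros)
  show ?thesis unfolding interleave_def[abs_def] by measurable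
qed

lemma interleave_separates:
  assumes u: "u \<in> unit_square" and v: "v \<in> unit_square" and close: "\<bar>interleave u - interleave v\<bar> < 1 / 2 / 8 ^ n"
  shows "\<bar>fst u - fst v\<bar> < 1 / 2 ^ n" "\<bar>snd u - snd v\<bar> < 1 / 2 ^ n"
proof -
  define d where "d z k = 2 * digit k (fst z) + digit k (snd z)" for z :: "real \<times> real" and k
  define c where "c k = real_of_int (d u k) - real_of_int (d v k)" for k
  have dr: "d z k \<in> {0..3}" for z k unfolding d_def by (rule interleave_digit_range)
  have c3: "\<bar>c k\<bar> \<le> 3" for k using dr[of u k] dr[of v k] by (auto simp: c_def)
  have d3: "\<bar>real_of_int (d z k)\<bar> \<le> 3" for z k using dr[of z k] by auto
  have diff: "interleave u - interleave v = (\<Sum>k. c k / 8 ^ k)"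
    unfolding interleave_def d_def[symmetric] c_def diff_divide_distrib
    by (rule suminf_diff) (rule summable_digits, rule d3)+
  have eq: "d u k = d v k" if "k \<le> n" for k
  proof (rule ccontr)
    assume ne: "d u k \<noteq> d v k"
    define N where "N = (LEAST k. d u k \<noteq> d v k)"
    have N: "d u N \<noteq> d v N" unfolding N_def by (rule LeastI[of "\<lambda>k. d u k \<noteq> d v k", OF ne])
    have Nk: "N \<le> k" unfolding N_def by (rule Least_le[of "\<lambda>k. d u k \<noteq> d v k", OF ne])
    have below: "c k = 0" if "k < N" for k
      using not_less_Least[OF that[unfolded N_def]] by (simp add: c_def)
    have "1 \<le> \<bar>d u N - d v N\<bar>" using N by linarith
    then have "1 \<le> \<bar>c N\<bar>" unfolding c_def by linarith
    then have "1 / 2 / 8 ^ N \<le> \<bar>interleave u - interleave v\<bar>"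
      unfolding diff using c3 below by (intro first_difference_gap)
    moreover have "1 / 2 / 8 ^ n \<le> (1 / 2 / 8 ^ N :: real)"
      using Nk that by (intro divide_left_mono power_increasing) auto
    ultimately show False using close by linarith
  qed
  have "digit k (fst u) = digit k (fst v) \<and> digit k (snd u) = digit k (snd v)" if "k \<le> n" for k
    using eq[OF that] digit_range[of k "fst u"] digit_range[of k "fst v"] digit_range[of k "snd u"] digit_range[of k "snd v"]
    unfolding d_def by auto
  then show "\<bar>fst u - fst v\<bar> < 1 / 2 ^ n" "\<bar>snd u - snd v\<bar> < 1 / 2 ^ n"
    using u v by (auto intro!: digits_determine simp: mem_Times_iff)
qed

text \<open>The inverse of the code is uniformly continuous on its range, so it extends continuously to the
closure, and by Dugundji's theorem from this closed set to the line without leaving the convex square.\<close>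

lemma continuous_decoder:
  obtains g :: "real \<Rightarrow> real \<times> real" where "continuous_on UNIV g" "range g \<subseteq> unit_square"
    "\<And>u. u \<in> unit_square \<Longrightarrow> g (interleave u) = u"
proof -
  define S where "S = interleave ` unit_square"
  have small: "\<exists>n. 2 / 2 ^ n < \<epsilon>" if "0 < \<epsilon>" for \<epsilon> :: real
  proof -
    have "\<exists>n. (1 / 2 :: real) ^ n < \<epsilon> / 2" by (rule real_arch_pow_inv) (use that in auto)
    then obtain n where "(1 / 2 :: real) ^ n < \<epsilon> / 2" by blast
    then show ?thesis by (intro exI[of _ n]) (simp add: power_divide)
  qed
  have close: "dist u v < \<epsilon>"
    if "u \<in> unit_square" "v \<in> unit_square" "\<bar>interleave u - interleave v\<bar> < 1 / 2 / 8 ^ n" "2 / 2 ^ n < \<epsilon>" for u v \<epsilon> n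
  proof -
    have "dist u v \<le> \<bar>fst u - fst v\<bar> + \<bar>snd u - snd v\<bar>"
      unfolding dist_prod_def dist_real_def
      using sqrt_sum_squares_le_sum_abs[of "fst u - fst v" "snd u - snd v"] by simp
    then show ?thesis using interleave_separates[OF that(1-3)] that(4) by linarith
  qed
  have inj: "inj_on interleave unit_square"
  proof (rule inj_onI)
    fix u v :: "real \<times> real" assume uv: "u \<in> unit_square" "v \<in> unit_square" "interleave u = interleave v"
    have "dist u v < \<epsilon>" if "0 < \<epsilon>" for \<epsilon>
      using small[OF that] close[OF uv(1,2)] uv(3) by auto
    then show "u = v" using zero_less_dist_iff[of u v] less_irrefl by blast
  qed
  define g0 where "g0 = the_inv_into unit_square interleave"
  have g0: "g0 (interleave u) = u" if "u \<in> unit_square" for u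
    unfolding g0_def by (rule the_inv_into_f_f[OF inj that])
  have uc: "uniformly_continuous_on S g0"
    unfolding uniformly_continuous_on_def
  proof (intro allI impI)
    fix \<epsilon> :: real assume "0 < \<epsilon>"
    then obtain n where n: "2 / 2 ^ n < \<epsilon>" using small by blast
    show "\<exists>d>0. \<forall>x\<in>S. \<forall>x'\<in>S. dist x' x < d \<longrightarrow> dist (g0 x') (g0 x) < \<epsilon>"
    proof (intro exI[of _ "1 / 2 / 8 ^ n"] conjI ballI impI)
      fix x x' assume "x \<in> S" "x' \<in> S" and d: "dist x' x < 1 / 2 / 8 ^ n"
      then obtain u v where "x = interleave u" "x' = interleave v" "u \<in> unit_square" "v \<in> unit_square"
        unfolding S_def by blast
      then show "dist (g0 x') (g0 x) < \<epsilon>" using close[of v u n \<epsilon>] d n by (simp add: g0 dist_real_def)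
    qed simp
  qed
  obtain g1 where g1: "uniformly_continuous_on (closure S) g1" "\<And>x. x \<in> S \<Longrightarrow> g0 x = g1 x"
    by (rule uniformly_continuous_on_extension_on_closure[OF uc]) blast
  have c1: "continuous_on (closure S) g1" using g1(1) by (rule uniformly_continuous_imp_continuous)
  have "g1 ` S \<subseteq> unit_square"
  proof (rule image_subsetI)
    fix x assume x: "x \<in> S"
    then obtain u where "x = interleave u" "u \<in> unit_square" unfolding S_def by blast
    then show "g1 x \<in> unit_square" using g1(2)[OF x] g0 by auto
  qed
  then have r1: "g1 ` closure S \<subseteq> unit_square"
    by (intro image_closure_subset[OF c1]) (auto intro: closed_Times)
  have cv: "convex (unit_square :: (real \<times> real) set)" by (intro convex_Times) auto
  have ne: "unit_square \<noteq> ({} :: (real \<times> real) set)" by auto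
  have cl: "closedin (top_of_set UNIV) (closure S)" by simp
  obtain g where g: "continuous_on UNIV g" "g ` UNIV \<subseteq> unit_square" "\<And>x. x \<in> closure S \<Longrightarrow> g x = g1 x"
    using Dugundji[OF cv ne cl c1 r1] by blast
  show thesis
  proof (rule that[OF g(1,2)])
    fix u :: "real \<times> real" assume u: "u \<in> unit_square"
    then have "interleave u \<in> S" by (simp add: S_def)
    then show "g (interleave u) = u"
      using g(3)[of "interleave u"] g1(2)[of "interleave u"] g0[OF u] closure_subset[of S] by auto
  qed
qed

lemma continuous_on_square_measurable:
  fixes f :: "real \<times> real \<Rightarrow> 'b::topological_space"
  assumes "continuous_on unit_square f"
  shows "f \<in> borel_measurable (restrict_space borel unit_square)"
  using assms by (rule borel_measurable_continuous_on_restrict)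

section \<open>Sequential compactness of the set of permutons\<close>

text \<open>Integrating \<open>f\<close> against a permuton is the same as integrating \<open>f \<circ> g\<close> against its image on the
line, where \<open>g\<close> inverts the code. As \<open>f \<circ> g\<close> is bounded and continuous, weak convergence on
the line transfers. The result type is general because the marginals need complex \<open>f\<close>.\<close>

lemma decoded_integral_tendsto:
  fixes f :: "real \<times> real \<Rightarrow> 'b::{banach, second_countable_topology}"
  assumes g: "continuous_on UNIV g" "range g \<subseteq> unit_square" "\<And>u. u \<in> unit_square \<Longrightarrow> g (interleave u) = u"
    and P: "\<And>n. P n \<in> permutons" and N: "real_distribution N"
    and weak: "weak_conv_m (\<lambda>n. distr (P n) borel interleave) N"
    and f: "continuous_on unit_square f"
  shows "(\<lambda>n. \<integral>z. f z \<partial>P n) \<longlonglongrightarrow> (\<integral>z. f z \<partial>distr N (restrict_space borel unit_square) g)"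
proof -
  interpret N: real_distribution N by (rule N)
  have im: "interleave \<in> P n \<rightarrow>\<^sub>M borel" for n
    using measurable_restrict_space1[OF interleave_measurable, of unit_square]
    by (simp cong: measurable_cong_sets add: permutonsD(2)[OF P])
  have fg: "continuous_on UNIV (\<lambda>x. f (g x))"
    by (rule continuous_on_compose2[OF f g(1,2)])
  have fgm: "(\<lambda>x. f (g x)) \<in> borel_measurable borel"
    by (rule borel_measurable_continuous_onI[OF fg])
  obtain B where B: "\<And>z. z \<in> unit_square \<Longrightarrow> norm (f z) \<le> B" using continuous_on_square_bounded[OF f] by blast
  have rd: "real_distribution (distr (P n) borel interleave)" for n
    using prob_space.prob_space_distr[OF permutonsD(1)[OF P] im] by (intro real_distribution.intro real_distribution_axioms.intro) auto
  have "(\<lambda>n. integral\<^sup>L (distr (P n) borel interleave) (\<lambda>x. f (g x))) \<longlonglongrightarrow> integral\<^sup>L N (\<lambda>x. f (g x))"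
  proof (rule weak_conv_imp_integral_bdd_continuous_conv[where B = B])
    show "isCont (\<lambda>x. f (g x)) x" for x using fg by (simp add: continuous_on_eq_continuous_at)
    show "norm (f (g x)) \<le> B" for x by (rule B) (use g(2) in blast)
  qed (fact rd N weak)+
  moreover have "integral\<^sup>L (distr (P n) borel interleave) (\<lambda>x. f (g x)) = (\<integral>z. f z \<partial>P n)" for n
  proof -
    have "integral\<^sup>L (distr (P n) borel interleave) (\<lambda>x. f (g x)) = (\<integral>z. f (g (interleave z)) \<partial>P n)"
      by (rule integral_distr[OF im fgm])
    also have "\<dots> = (\<integral>z. f z \<partial>P n)"
      by (rule Bochner_Integration.integral_cong[OF refl]) (simp add: permutonsD(3)[OF P] g(3))
    finally show ?thesis .
  qed
  moreover have "(\<integral>z. f z \<partial>distr N (restrict_space borel unit_square) g) = integral\<^sup>L N (\<lambda>x. f (g x))"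
  proof (rule integral_distr)
    have "g \<in> borel \<rightarrow>\<^sub>M restrict_space borel unit_square"
      using g(2) by (intro measurable_restrict_space2 borel_measurable_continuous_onI[OF g(1)]) auto
    then show "g \<in> N \<rightarrow>\<^sub>M restrict_space borel unit_square" by (simp cong: measurable_cong_sets)
    show "f \<in> borel_measurable (restrict_space borel unit_square)" by (rule continuous_on_square_measurable[OF f])
  qed
  ultimately show ?thesis by simp
qed

text \<open>The characteristic function of the projection is the integral of a continuous function on the square.
Its value does not change along the sequence, so it is the same for the limit, and characteristic
functions determine laws on the line.\<close>

lemma uniform_marginal_limit:
  fixes \<pi> :: "real \<times> real \<Rightarrow> real"
  assumes \<pi>: "continuous_on unit_square \<pi>" "\<pi> \<in> unit_square \<rightarrow> {0..1}"
    and P: "\<And>n. sets (P n) = sets (restrict_space borel unit_square)"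
      "\<And>n. distr (P n) (restrict_space borel {0..1}) \<pi> = restrict_space lborel {0..1}"
    and Q: "prob_space Q" "sets Q = sets (restrict_space borel unit_square)"
    and lim: "\<And>f :: real \<times> real \<Rightarrow> complex. continuous_on unit_square f \<Longrightarrow> (\<lambda>n. \<integral>z. f z \<partial>P n) \<longlonglongrightarrow> (\<integral>z. f z \<partial>Q)"
  shows "distr Q (restrict_space borel {0..1}) \<pi> = restrict_space lborel {0..1}"
proof -
  let ?I = "restrict_space lborel {0..1::real}"
  interpret Q: prob_space Q by (rule Q)
  have \<pi>m: "\<pi> \<in> restrict_space borel unit_square \<rightarrow>\<^sub>M borel" by (rule continuous_on_square_measurable[OF \<pi>(1)])
  have \<pi>mr: "\<pi> \<in> restrict_space borel unit_square \<rightarrow>\<^sub>M restrict_space borel {0..1}"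
    using \<pi> \<pi>m by (intro measurable_restrict_space2) (auto simp: space_restrict_space)
  have \<pi>Q: "\<pi> \<in> Q \<rightarrow>\<^sub>M borel" "\<pi> \<in> Q \<rightarrow>\<^sub>M restrict_space borel {0..1}"
    and \<pi>P: "\<pi> \<in> P n \<rightarrow>\<^sub>M restrict_space borel {0..1}" for n
    using \<pi>m \<pi>mr by (simp_all cong: measurable_cong_sets add: P Q)
  have idm: "(\<lambda>x. x) \<in> ?I \<rightarrow>\<^sub>M borel" by (rule measurable_restrict_space1) simp
  have rQ: "real_distribution (distr Q borel \<pi>)"
    using Q.prob_space_distr[OF \<pi>Q(1)] by (intro real_distribution.intro real_distribution_axioms.intro) auto
  have rI: "real_distribution (distr ?I borel (\<lambda>x. x))"
    using prob_space.prob_space_distr[OF prob_space_unit_interval idm] by (intro real_distribution.intro real_distribution_axioms.intro) auto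
  have "char (distr Q borel \<pi>) = char (distr ?I borel (\<lambda>x. x))"
  proof
    fix t :: real
    have em: "(\<lambda>x. iexp (t * x)) \<in> borel_measurable borel" by measurable
    have cf: "continuous_on unit_square (\<lambda>z. iexp (t * \<pi> z))" by (intro continuous_intros \<pi>(1))
    have "(\<integral>z. iexp (t * \<pi> z) \<partial>P n) = (\<integral>x. iexp (t * x) \<partial>?I)" for n
    proof -
      have "(\<integral>x. iexp (t * x) \<partial>?I) = (\<integral>x. iexp (t * x) \<partial>distr (P n) (restrict_space borel {0..1}) \<pi>)"
        by (simp add: P)
      also have "\<dots> = (\<integral>z. iexp (t * \<pi> z) \<partial>P n)"
        by (rule integral_distr[OF \<pi>P]) (rule measurable_restrict_space1[OF em])
      finally show ?thesis by simp
    qed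
    then have "(\<lambda>n. \<integral>x. iexp (t * x) \<partial>?I) \<longlonglongrightarrow> (\<integral>z. iexp (t * \<pi> z) \<partial>Q)" using lim[OF cf] by simp
    then have "(\<integral>z. iexp (t * \<pi> z) \<partial>Q) = (\<integral>x. iexp (t * x) \<partial>?I)"
      using LIMSEQ_unique tendsto_const by blast
    moreover have "char (distr Q borel \<pi>) t = (\<integral>z. iexp (t * \<pi> z) \<partial>Q)"
      unfolding char_def by (rule integral_distr[OF \<pi>Q(1) em])
    moreover have "char (distr ?I borel (\<lambda>x. x)) t = (\<integral>x. iexp (t * x) \<partial>?I)"
      unfolding char_def by (rule integral_distr[OF idm em])
    ultimately show "char (distr Q borel \<pi>) t = char (distr ?I borel (\<lambda>x. x)) t" by simp
  qed
  then have eq: "distr Q borel \<pi> = distr ?I borel (\<lambda>x. x)" by (rule Levy_uniqueness[OF rQ rI])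
  show ?thesis
  proof (rule measure_eqI)
    show "sets (distr Q (restrict_space borel {0..1}) \<pi>) = sets ?I" by (simp cong: sets_restrict_space_cong)
    fix B assume "B \<in> sets (distr Q (restrict_space borel {0..1}) \<pi>)"
    then have Br: "B \<in> sets (restrict_space borel {0..1})" by simp
    then have B: "B \<in> sets borel" "B \<subseteq> {0..1}" by (auto simp: sets_restrict_space_iff)
    have "emeasure (distr Q (restrict_space borel {0..1}) \<pi>) B = emeasure (distr Q borel \<pi>) B"
      by (simp add: emeasure_distr \<pi>Q B Br)
    also have "\<dots> = emeasure ?I (B \<inter> {0..1})"
      unfolding eq using B by (subst emeasure_distr[OF idm]) (auto simp: space_restrict_space)
    also have "B \<inter> {0..1} = B" using B by auto
    finally show "emeasure (distr Q (restrict_space borel {0..1}) \<pi>) B = emeasure ?I B" .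
  qed
qed

theorem permutons_sequentially_compact:
  assumes P: "\<And>n. P n \<in> permutons"
  shows "\<exists>Q\<in>permutons. \<exists>r :: nat \<Rightarrow> nat. strict_mono r \<and>
    (\<forall>f :: real \<times> real \<Rightarrow> real. continuous_on unit_square f \<longrightarrow> (\<lambda>n. \<integral>z. f z \<partial>P (r n)) \<longlonglongrightarrow> (\<integral>z. f z \<partial>Q))"
proof -
  obtain g where g: "continuous_on UNIV g" "range g \<subseteq> unit_square" "\<And>u. u \<in> unit_square \<Longrightarrow> g (interleave u) = u"
    using continuous_decoder by blast
  define \<nu> where "\<nu> n = distr (P n) borel interleave" for n
  have im: "interleave \<in> P n \<rightarrow>\<^sub>M borel" for n
    using measurable_restrict_space1[OF interleave_measurable, of unit_square]
    by (simp cong: measurable_cong_sets add: permutonsD(2)[OF P])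
  have rd: "real_distribution (\<nu> n)" for n
    using prob_space.prob_space_distr[OF permutonsD(1)[OF P] im] unfolding \<nu>_def
    by (intro real_distribution.intro real_distribution_axioms.intro) auto
  have "tight \<nu>"
    unfolding tight_def
  proof (intro conjI allI impI rd)
    fix \<epsilon> :: real assume "0 < \<epsilon>"
    \<comment> \<open>all codes lie in the bounded interval \<open>[-4, 4]\<close>\<close>
    have "measure (\<nu> n) {-5<..5} = 1" for n
    proof -
      have "interleave -` {-5<..5} \<inter> space (P n) = space (P n)"
      proof -
        have "-5 < interleave z \<and> interleave z \<le> 5" for z using interleave_bounds[of z] by linarith
        then show ?thesis by auto
      qed
      then have "measure (\<nu> n) {-5<..5} = measure (P n) (space (P n))"
        unfolding \<nu>_def by (simp add: measure_distr[OF im])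
      then show ?thesis using prob_space.prob_space[OF permutonsD(1)[OF P]] by simp
    qed
    then show "\<exists>a b. a < b \<and> (\<forall>n. 1 - \<epsilon> < measure (\<nu> n) {a<..b})"
      using \<open>0 < \<epsilon>\<close> by (intro exI[of _ "-5"] exI[of _ 5]) auto
  qed
  then obtain r N where r: "strict_mono r" and N: "real_distribution N" and weak: "weak_conv_m (\<nu> \<circ> id \<circ> r) N"
    using tight_imp_convergent_subsubsequence[of \<nu> id] strict_mono_id by blast
  have weak': "weak_conv_m (\<lambda>n. distr (P (r n)) borel interleave) N" using weak by (simp add: \<nu>_def comp_def)
  define Q where "Q = distr N (restrict_space borel unit_square) g"
  interpret N: real_distribution N by (rule N)
  have "g \<in> borel \<rightarrow>\<^sub>M restrict_space borel unit_square"
    using g(2) by (intro measurable_restrict_space2 borel_measurable_continuous_onI[OF g(1)]) auto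
  then have gm: "g \<in> N \<rightarrow>\<^sub>M restrict_space borel unit_square" by (simp cong: measurable_cong_sets)
  have Q: "prob_space Q" "sets Q = sets (restrict_space borel unit_square)"
    unfolding Q_def by (auto intro: N.prob_space_distr[OF gm])
  have lim: "(\<lambda>n. \<integral>z. f z \<partial>P (r n)) \<longlonglongrightarrow> (\<integral>z. f z \<partial>Q)" if "continuous_on unit_square f" for f :: "real \<times> real \<Rightarrow> real"
    unfolding Q_def by (rule decoded_integral_tendsto) (fact g P N weak' that)+
  have limc: "(\<lambda>n. \<integral>z. f z \<partial>P (r n)) \<longlonglongrightarrow> (\<integral>z. f z \<partial>Q)" if "continuous_on unit_square f" for f :: "real \<times> real \<Rightarrow> complex"
    unfolding Q_def by (rule decoded_integral_tendsto) (fact g P N weak' that)+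
  have marg: "distr Q (restrict_space borel {0..1}) \<pi> = restrict_space lborel {0..1}"
    if "continuous_on unit_square \<pi>" "\<pi> \<in> unit_square \<rightarrow> {0..1}"
      "\<And>n. distr (P n) (restrict_space borel {0..1}) \<pi> = restrict_space lborel {0..1}" for \<pi> :: "real \<times> real \<Rightarrow> real"
  proof (rule uniform_marginal_limit[where P = "\<lambda>n. P (r n)"])
    show "sets (P (r n)) = sets (restrict_space borel unit_square)" for n by (rule permutonsD(2)[OF P])
    show "distr (P (r n)) (restrict_space borel {0..1}) \<pi> = restrict_space lborel {0..1}" for n by (rule that(3))
  qed (use that(1,2) Q limc in blast)+
  have "distr Q (restrict_space borel {0..1}) fst = restrict_space lborel {0..1}"
    by (rule marg) (auto intro: permutonsD(4)[OF P] continuous_on_fst[OF continuous_on_id])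
  moreover have "distr Q (restrict_space borel {0..1}) snd = restrict_space lborel {0..1}"
    by (rule marg) (auto intro: permutonsD(5)[OF P] continuous_on_snd[OF continuous_on_id])
  ultimately have "Q \<in> permutons"
    unfolding permutons_def using Q by blast
  then show ?thesis using r lim by blast
qed

section \<open>Countable description of the weak topology\<close>

lemma topspace_weak_topology: "topspace weak_topology = permutons"
proof -
  have "permutons \<in> {{\<mu> \<in> permutons. (\<integral>x. f x \<partial>\<mu>) \<in> U} | (f :: real \<times> real \<Rightarrow> real) U.
        continuous_on unit_square f \<and> open U}"
    by (intro CollectI exI[of _ "\<lambda>_. 0"] exI[of _ UNIV]) auto
  then show ?thesis unfolding weak_topology_def topology_generated_by_topspace by auto
qed

lemma permuton_integrable:
  fixes f :: "real \<times> real \<Rightarrow> real"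
  assumes P: "P \<in> permutons" and f: "continuous_on unit_square f"
  shows "integrable P f"
proof -
  interpret prob_space P by (rule permutonsD(1)[OF P])
  obtain B where B: "\<And>z. z \<in> unit_square \<Longrightarrow> norm (f z) \<le> B" using continuous_on_square_bounded[OF f] by blast
  show ?thesis
  proof (rule integrable_const_bound[of _ B])
    show "AE z in P. norm (f z) \<le> B" by (rule AE_I2) (use B permutonsD(3)[OF P] in auto)
    show "f \<in> borel_measurable P"
      using continuous_on_square_measurable[OF f] by (simp cong: measurable_cong_sets add: permutonsD(2)[OF P])
  qed
qed

lemma permuton_integral_close:
  fixes f g :: "real \<times> real \<Rightarrow> real"
  assumes P: "P \<in> permutons" and f: "continuous_on unit_square f" and g: "continuous_on unit_square g"
    and close: "\<And>z. z \<in> unit_square \<Longrightarrow> \<bar>f z - g z\<bar> \<le> \<delta>"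
  shows "\<bar>(\<integral>z. f z \<partial>P) - (\<integral>z. g z \<partial>P)\<bar> \<le> \<delta>"
proof -
  interpret prob_space P by (rule permutonsD(1)[OF P])
  have i: "integrable P f" "integrable P g" using permuton_integrable[OF P] f g by auto
  have "(\<integral>z. f z \<partial>P) - (\<integral>z. g z \<partial>P) = (\<integral>z. f z - g z \<partial>P)" using i by simp
  also have "\<bar>\<dots>\<bar> \<le> (\<integral>z. \<bar>f z - g z\<bar> \<partial>P)" by (rule integral_abs_bound)
  also have "\<dots> \<le> (\<integral>z. \<delta> \<partial>P)"
    using i close permutonsD(3)[OF P] by (intro integral_mono) auto
  finally show ?thesis by (simp add: prob_space)
qed

text \<open>For a subbasic set \<open>{\<mu>. \<integral>f d\<mu> \<in> V}\<close> one polynomial that is uniformly close to \<open>f\<close> suffices, since all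
measures involved are probability measures; finite intersections and unions preserve the claim.\<close>

lemma weak_open_contains_polynomial_nhd:
  assumes "openin weak_topology U" "\<mu> \<in> U"
  shows "\<exists>E \<epsilon>. finite E \<and> 0 < \<epsilon> \<and>
    {\<nu> \<in> permutons. \<forall>e\<in>E. \<bar>(\<integral>z. poly_eval e z \<partial>\<nu>) - (\<integral>z. poly_eval e z \<partial>\<mu>)\<bar> < \<epsilon>} \<subseteq> U"
proof -
  define nhd where "nhd E \<epsilon> = {\<nu> \<in> permutons. \<forall>e\<in>E. \<bar>(\<integral>z. poly_eval e z \<partial>\<nu>) - (\<integral>z. poly_eval e z \<partial>\<mu>)\<bar> < \<epsilon>}"
    for E and \<epsilon> :: real
  have "\<mu> \<in> U \<longrightarrow> (\<exists>E \<epsilon>. finite E \<and> 0 < \<epsilon> \<and> nhd E \<epsilon> \<subseteq> U)"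
    using assms(1) unfolding weak_topology_def openin_topology_generated_by_iff
  proof (induction rule: generate_topology_on.induct)
    case Empty show ?case by simp
  next
    case (Int a b)
    show ?case
    proof
      assume "\<mu> \<in> a \<inter> b"
      then obtain E \<epsilon> E' \<epsilon>' where *: "finite E" "0 < \<epsilon>" "nhd E \<epsilon> \<subseteq> a" "finite E'" "0 < \<epsilon>'" "nhd E' \<epsilon>' \<subseteq> b"
        using Int.IH by auto
      have "nhd (E \<union> E') (min \<epsilon> \<epsilon>') \<subseteq> nhd E \<epsilon> \<inter> nhd E' \<epsilon>'" unfolding nhd_def by auto
      then have "nhd (E \<union> E') (min \<epsilon> \<epsilon>') \<subseteq> a \<inter> b" using * by blast
      then show "\<exists>E \<epsilon>. finite E \<and> 0 < \<epsilon> \<and> nhd E \<epsilon> \<subseteq> a \<inter> b"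
        using * by (intro exI[of _ "E \<union> E'"] exI[of _ "min \<epsilon> \<epsilon>'"]) auto
    qed
  next
    case (UN K)
    show ?case
    proof
      assume "\<mu> \<in> \<Union>K"
      then obtain k where k: "k \<in> K" "\<mu> \<in> k" by blast
      then obtain E \<epsilon> where "finite E" "0 < \<epsilon>" "nhd E \<epsilon> \<subseteq> k" using UN.IH[OF k(1)] by blast
      then show "\<exists>E \<epsilon>. finite E \<and> 0 < \<epsilon> \<and> nhd E \<epsilon> \<subseteq> \<Union>K" using k(1)
        by (intro exI[of _ E] exI[of _ \<epsilon>]) blast
    qed
  next
    case (Basis s)
    then obtain f :: "real \<times> real \<Rightarrow> real" and V where s: "s = {\<mu> \<in> permutons. (\<integral>x. f x \<partial>\<mu>) \<in> V}"
      and f: "continuous_on unit_square f" and V: "open V" by blast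
    show ?case
    proof
      assume "\<mu> \<in> s"
      then have \<mu>: "\<mu> \<in> permutons" "(\<integral>x. f x \<partial>\<mu>) \<in> V" by (auto simp: s)
      obtain \<delta> where \<delta>: "0 < \<delta>" "\<And>y. \<bar>y - (\<integral>x. f x \<partial>\<mu>)\<bar> < \<delta> \<Longrightarrow> y \<in> V"
        using V \<mu>(2) unfolding open_dist dist_real_def by blast
      obtain e where e: "\<And>z. z \<in> unit_square \<Longrightarrow> \<bar>f z - poly_eval e z\<bar> < \<delta> / 3"
        using poly_expr_dense[OF f, of "\<delta> / 3"] \<delta>(1) by auto
      have close: "\<bar>(\<integral>z. f z \<partial>\<nu>) - (\<integral>z. poly_eval e z \<partial>\<nu>)\<bar> \<le> \<delta> / 3" if "\<nu> \<in> permutons" for \<nu>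
        by (rule permuton_integral_close[OF that f continuous_on_poly_eval]) (rule less_imp_le[OF e])
      have "nhd {e} (\<delta> / 3) \<subseteq> s"
      proof
        fix \<nu> assume "\<nu> \<in> nhd {e} (\<delta> / 3)"
        then have \<nu>: "\<nu> \<in> permutons" and ne: "\<bar>(\<integral>z. poly_eval e z \<partial>\<nu>) - (\<integral>z. poly_eval e z \<partial>\<mu>)\<bar> < \<delta> / 3"
          by (auto simp: nhd_def)
        have "\<bar>(\<integral>z. f z \<partial>\<nu>) - (\<integral>z. f z \<partial>\<mu>)\<bar> < \<delta>"
          using close[OF \<nu>] close[OF \<mu>(1)] ne by linarith
        then show "\<nu> \<in> s" using \<delta>(2) \<nu> by (simp add: s)
      qed
      then show "\<exists>E \<epsilon>. finite E \<and> 0 < \<epsilon> \<and> nhd E \<epsilon> \<subseteq> s"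
        using \<delta>(1) by (intro exI[of _ "{e}"] exI[of _ "\<delta> / 3"]) auto
    qed
  qed
  then show ?thesis using assms(2) unfolding nhd_def by blast
qed

lemma weak_limitI:
  assumes Q: "Q \<in> permutons" and P: "\<forall>\<^sub>F n in sequentially. P n \<in> permutons"
    and lim: "\<And>e. (\<lambda>n. \<integral>z. poly_eval e z \<partial>P n) \<longlonglongrightarrow> (\<integral>z. poly_eval e z \<partial>Q)"
  shows "limitin weak_topology P Q sequentially"
  unfolding limitin_def topspace_weak_topology
proof (intro conjI allI impI Q)
  fix U assume "openin weak_topology U \<and> Q \<in> U"
  then obtain E \<epsilon> where E: "finite E" "0 < \<epsilon>"
    and sub: "{\<nu> \<in> permutons. \<forall>e\<in>E. \<bar>(\<integral>z. poly_eval e z \<partial>\<nu>) - (\<integral>z. poly_eval e z \<partial>Q)\<bar> < \<epsilon>} \<subseteq> U"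
    using weak_open_contains_polynomial_nhd[of U Q] by blast
  have "\<forall>\<^sub>F n in sequentially. \<forall>e\<in>E. \<bar>(\<integral>z. poly_eval e z \<partial>P n) - (\<integral>z. poly_eval e z \<partial>Q)\<bar> < \<epsilon>"
    using E(2) by (intro eventually_ball_finite[OF E(1)] ballI tendstoD[OF lim, unfolded dist_real_def])
  then show "\<forall>\<^sub>F n in sequentially. P n \<in> U"
    using P by eventually_elim (use sub in auto)
qed

text \<open>The parameter lists form a countable type, so that a union of boxes is always a countable union.\<close>

definition rational_box :: "(poly_expr \<times> rat \<times> rat) list \<Rightarrow> (real \<times> real) measure set" where
  "rational_box L = {\<nu> \<in> permutons. \<forall>(e, q, r) \<in> set L. \<bar>(\<integral>z. poly_eval e z \<partial>\<nu>) - of_rat q\<bar> < of_rat r}"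

lemma weak_open_eq_Union_boxes:
  assumes U: "openin weak_topology U"
  shows "U = (\<Union>L\<in>{L. rational_box L \<subseteq> U}. rational_box L)"
proof (intro equalityI subsetI)
  fix \<mu> assume \<mu>: "\<mu> \<in> U"
  have \<mu>p: "\<mu> \<in> permutons" using openin_subset[OF U] \<mu> by (auto simp: topspace_weak_topology)
  obtain E \<epsilon> where E: "finite E" "0 < \<epsilon>"
    and sub: "{\<nu> \<in> permutons. \<forall>e\<in>E. \<bar>(\<integral>z. poly_eval e z \<partial>\<nu>) - (\<integral>z. poly_eval e z \<partial>\<mu>)\<bar> < \<epsilon>} \<subseteq> U"
    using weak_open_contains_polynomial_nhd[OF U \<mu>] by blast
  obtain es where es: "set es = E" using finite_list[OF E(1)] by blast
  obtain r where r: "0 < (of_rat r :: real)" "of_rat r < \<epsilon> / 2"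
    using of_rat_dense[of 0 "\<epsilon> / 2"] E(2) by (metis half_gt_zero)
  have "\<exists>q. \<bar>(\<integral>z. poly_eval e z \<partial>\<mu>) - of_rat q\<bar> < of_rat r" for e
  proof -
    obtain q where "(\<integral>z. poly_eval e z \<partial>\<mu>) < of_rat q" "of_rat q < (\<integral>z. poly_eval e z \<partial>\<mu>) + of_rat r"
      using of_rat_dense[of "\<integral>z. poly_eval e z \<partial>\<mu>" "(\<integral>z. poly_eval e z \<partial>\<mu>) + of_rat r"] r(1) by (metis less_add_same_cancel1)
    then have "\<bar>(\<integral>z. poly_eval e z \<partial>\<mu>) - of_rat q\<bar> < of_rat r" by linarith
    then show ?thesis by blast
  qed
  then obtain q where q: "\<And>e. \<bar>(\<integral>z. poly_eval e z \<partial>\<mu>) - of_rat (q e)\<bar> < of_rat r" by metis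
  define L where "L = map (\<lambda>e. (e, q e, r)) es"
  have L: "rational_box L = {\<nu> \<in> permutons. \<forall>e\<in>E. \<bar>(\<integral>z. poly_eval e z \<partial>\<nu>) - of_rat (q e)\<bar> < of_rat r}"
    unfolding rational_box_def L_def by (auto simp: es)
  have "rational_box L \<subseteq> {\<nu> \<in> permutons. \<forall>e\<in>E. \<bar>(\<integral>z. poly_eval e z \<partial>\<nu>) - (\<integral>z. poly_eval e z \<partial>\<mu>)\<bar> < \<epsilon>}"
  proof (intro subsetI CollectI conjI ballI)
    fix \<nu> e assume "\<nu> \<in> rational_box L" "e \<in> E"
    then have "\<bar>(\<integral>z. poly_eval e z \<partial>\<nu>) - of_rat (q e)\<bar> < of_rat r" by (simp add: L)
    then show "\<bar>(\<integral>z. poly_eval e z \<partial>\<nu>) - (\<integral>z. poly_eval e z \<partial>\<mu>)\<bar> < \<epsilon>" using q[of e] r(2) by linarith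
  qed (simp add: L)
  then have "rational_box L \<subseteq> U" using sub by blast
  moreover have "\<mu> \<in> rational_box L" using \<mu>p q by (simp add: L)
  ultimately show "\<mu> \<in> (\<Union>L\<in>{L. rational_box L \<subseteq> U}. rational_box L)" by blast
qed blast

text \<open>The Borel sets are generated by all open sets, but each of them is a countable union of boxes, which
only involve finitely many integrals.\<close>

lemma measurable_borel_permutonsI:
  assumes \<mu>: "\<And>\<omega>. \<omega> \<in> space M \<Longrightarrow> \<mu> \<omega> \<in> permutons"
    and m: "\<And>e. (\<lambda>\<omega>. \<integral>z. poly_eval e z \<partial>\<mu> \<omega>) \<in> borel_measurable M"
  shows "\<mu> \<in> M \<rightarrow>\<^sub>M borel_permutons"
  unfolding borel_permutons_def
proof (rule measurable_measure_of)
  show "{U. openin weak_topology U} \<subseteq> Pow permutons"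
    using openin_subset topspace_weak_topology by blast
  show "\<mu> \<in> space M \<rightarrow> permutons" using \<mu> by auto
  fix U assume "U \<in> {U. openin weak_topology U}"
  then have U: "U = (\<Union>L\<in>{L. rational_box L \<subseteq> U}. rational_box L)" using weak_open_eq_Union_boxes by blast
  have box: "\<mu> -` rational_box L \<inter> space M \<in> sets M" for L
  proof -
    have "\<mu> -` rational_box L \<inter> space M = {\<omega> \<in> space M. \<forall>t\<in>set L. \<bar>(\<integral>z. poly_eval (fst t) z \<partial>\<mu> \<omega>) - of_rat (fst (snd t))\<bar> < of_rat (snd (snd t))}"
      using \<mu> by (auto simp: rational_box_def case_prod_beta)
    also have "\<dots> \<in> sets M"
      by (intro sets.sets_Collect_finite_All borel_measurable_less borel_measurable_abs borel_measurable_diff m borel_measurable_const) auto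
    finally show ?thesis .
  qed
  have "\<mu> -` U \<inter> space M = (\<Union>L\<in>{L. rational_box L \<subseteq> U}. \<mu> -` rational_box L \<inter> space M)"
    by (subst U) auto
  also have "\<dots> \<in> sets M" by (rule sets.countable_UN') (auto intro: box)
  finally show "\<mu> -` U \<inter> space M \<in> sets M" .
qed

section \<open>The random limit permuton\<close>

text \<open>Compactness provides a limit along a subsequence. The integrals converge along the whole sequence, so
their limits are those of the subsequence.\<close>

theorem permuton_limit_exists:
  assumes w: "\<And>n. 1 \<le> n \<Longrightarrow> w n \<in> perms n"
    and conv: "\<And>e. convergent (\<lambda>n. graph_avg (poly_eval e) (w n))"
  shows "\<exists>Q\<in>permutons. \<forall>e. (\<lambda>n. \<integral>z. poly_eval e z \<partial>permuton_of (w n)) \<longlonglongrightarrow> (\<integral>z. poly_eval e z \<partial>Q)"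
proof -
  define P where "P n = permuton_of (w (Suc n))" for n
  have P: "P n \<in> permutons" for n unfolding P_def by (rule permuton_of_in_permutons[OF w]) auto
  obtain Q r where Q: "Q \<in> permutons" and r: "strict_mono (r :: nat \<Rightarrow> nat)"
    and lim: "\<forall>f :: real \<times> real \<Rightarrow> real. continuous_on unit_square f \<longrightarrow> (\<lambda>n. \<integral>z. f z \<partial>P (r n)) \<longlonglongrightarrow> (\<integral>z. f z \<partial>Q)"
    using permutons_sequentially_compact[of P, OF P] by (elim bexE exE conjE)
  have "(\<lambda>n. \<integral>z. poly_eval e z \<partial>permuton_of (w n)) \<longlonglongrightarrow> (\<integral>z. poly_eval e z \<partial>Q)" for e
  proof -
    obtain gx gy C where b: "second_order_bound (poly_eval e) gx gy C"
      using second_order_poly_eval unfolding second_order_def by blast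
    obtain l where l: "(\<lambda>n. graph_avg (poly_eval e) (w n)) \<longlonglongrightarrow> l" using conv unfolding convergent_def by blast
    have "(\<lambda>n. (\<integral>z. poly_eval e z \<partial>permuton_of (w n)) - graph_avg (poly_eval e) (w n)) \<longlonglongrightarrow> 0"
    proof (rule Lim_null_comparison)
      show "\<forall>\<^sub>F n in sequentially. norm ((\<integral>z. poly_eval e z \<partial>permuton_of (w n)) - graph_avg (poly_eval e) (w n)) \<le> 4 * C * inverse (real n)"
      proof (rule eventually_sequentiallyI)
        fix n :: nat assume n: "1 \<le> n"
        show "norm ((\<integral>z. poly_eval e z \<partial>permuton_of (w n)) - graph_avg (poly_eval e) (w n)) \<le> 4 * C * inverse (real n)"
          using integral_permuton_of[OF w[OF n] n b borel_measurable_continuous_onI[OF continuous_on_poly_eval]]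
          by (simp add: divide_inverse)
      qed
      show "(\<lambda>n. 4 * C * inverse (real n)) \<longlonglongrightarrow> 0" by (intro tendsto_mult_right_zero lim_inverse_n)
    qed
    from tendsto_add[OF this l] have whole: "(\<lambda>n. \<integral>z. poly_eval e z \<partial>permuton_of (w n)) \<longlonglongrightarrow> l" by simp
    then have "(\<lambda>n. \<integral>z. poly_eval e z \<partial>P n) \<longlonglongrightarrow> l" unfolding P_def by (rule LIMSEQ_Suc)
    then have "(\<lambda>n. \<integral>z. poly_eval e z \<partial>P (r n)) \<longlonglongrightarrow> l" using LIMSEQ_subseq_LIMSEQ[OF _ r] by (simp add: comp_def)
    then have "l = (\<integral>z. poly_eval e z \<partial>Q)" using lim[rule_format, OF continuous_on_poly_eval] by (rule LIMSEQ_unique)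
    then show ?thesis using whole by simp
  qed
  then show ?thesis using Q by blast
qed


text \<open>Outside a null set \<open>N\<close> the process coincides with the chain driven by \<open>(J, B)\<close> and all averages
converge; there the limit permuton is chosen. It is determined by its integrals against
rational polynomials, and these are limits of random variables; this makes the choice measurable. On
\<open>N\<close> any fixed permuton will do.\<close>

theorem theorem1p2:
  fixes M :: "'a measure" and p :: real and \<sigma> :: "nat \<Rightarrow> 'a \<Rightarrow> nat list"
  assumes "prob_space M"
    and "0 < p" and "p < 1"
    and "recursive_separable_process M p \<sigma>"
  shows "\<exists>\<mu> :: 'a \<Rightarrow> (real \<times> real) measure.
           \<mu> \<in> M \<rightarrow>\<^sub>M borel_permutons \<and>
           (AE \<omega> in M. limitin weak_topology (\<lambda>n. permuton_of (\<sigma> n \<omega>)) (\<mu> \<omega>) sequentially)"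
proof -
  obtain J B where \<sigma>m: "\<And>n. 1 \<le> n \<Longrightarrow> \<sigma> n \<in> M \<rightarrow>\<^sub>M count_space UNIV"
    and \<sigma>1: "AE \<omega> in M. \<sigma> 1 \<omega> = [1]"
    and ind: "prob_space.indep_vars M (\<lambda>_. count_space UNIV) (\<lambda>n \<omega>. (J n \<omega>, B n \<omega>)) {1..}"
    and dis: "\<And>n. 1 \<le> n \<Longrightarrow> distr M (count_space UNIV) (\<lambda>\<omega>. (J n \<omega>, B n \<omega>)) =
                 measure_pmf (pair_pmf (pmf_of_set {1..n}) (bernoulli_pmf p))"
    and step: "\<And>n. 1 \<le> n \<Longrightarrow> AE \<omega> in M. \<sigma> (n + 1) \<omega> = grow (J n \<omega>) (B n \<omega>) (\<sigma> n \<omega>)"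
    using assms(4) unfolding recursive_separable_process_def by blast
  interpret growth_driver M "\<lambda>n \<omega>. (J n \<omega>, B n \<omega>)" "bernoulli_pmf p"
    using assms(1) ind dis by (intro growth_driver.intro growth_driver_axioms.intro)
  have "AE \<omega> in M. 1 \<le> n \<longrightarrow> \<sigma> (n + 1) \<omega> = grow (J n \<omega>) (B n \<omega>) (\<sigma> n \<omega>)" for n
    using step[of n] by (cases "1 \<le> n") simp_all
  then have "AE \<omega> in M. \<forall>n. 1 \<le> n \<longrightarrow> \<sigma> (n + 1) \<omega> = grow (J n \<omega>) (B n \<omega>) (\<sigma> n \<omega>)"
    unfolding AE_all_countable by blast
  with \<sigma>1 have \<sigma>_chain: "AE \<omega> in M. \<forall>n\<ge>1. \<sigma> n \<omega> = chain n \<omega>"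
  proof eventually_elim
    case (elim \<omega>)
    show ?case
    proof (intro allI impI)
      fix n :: nat assume "1 \<le> n"
      then show "\<sigma> n \<omega> = chain n \<omega>"
      proof (induction n rule: nat_induct_at_least)
        case base show ?case using elim(1) by (simp add: chain_def)
      next
        case (Suc n)
        then show ?case using elim(2)[rule_format, OF Suc.hyps] by (simp add: chain_Suc)
      qed
    qed
  qed
  have conv: "AE \<omega> in M. \<forall>e. convergent (\<lambda>n. graph_avg (poly_eval e) (chain n \<omega>))"
    unfolding AE_all_countable using AE_convergent_graph_avg[OF second_order_poly_eval] by blast
  \<comment> \<open>The index is shifted by one because \<open>\<sigma> 0\<close> is arbitrary, possibly not even measurable.\<close>
  define is_limit where "is_limit \<omega> Q \<longleftrightarrow> Q \<in> permutons \<and>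
    (\<forall>e. (\<lambda>n. \<integral>z. poly_eval e z \<partial>permuton_of (\<sigma> (Suc n) \<omega>)) \<longlonglongrightarrow> (\<integral>z. poly_eval e z \<partial>Q))" for \<omega> Q
  have good: "AE \<omega> in M. (\<forall>n\<ge>1. \<sigma> n \<omega> \<in> perms n) \<and> (\<exists>Q. is_limit \<omega> Q)"
    using conv \<sigma>_chain AE_chain_perms
  proof eventually_elim
    case (elim \<omega>)
    obtain Q where Q: "Q \<in> permutons" "\<forall>e. (\<lambda>n. \<integral>z. poly_eval e z \<partial>permuton_of (chain n \<omega>)) \<longlonglongrightarrow> (\<integral>z. poly_eval e z \<partial>Q)"
      using permuton_limit_exists[of "\<lambda>n. chain n \<omega>"] elim(1,3) by blast
    have "(\<lambda>n. \<integral>z. poly_eval e z \<partial>permuton_of (\<sigma> (Suc n) \<omega>)) \<longlonglongrightarrow> (\<integral>z. poly_eval e z \<partial>Q)" for e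
      using LIMSEQ_Suc[OF Q(2)[rule_format, of e]] elim(2) by simp
    then have "is_limit \<omega> Q" using Q(1) by (simp add: is_limit_def)
    then show ?case using elim(2,3) by auto
  qed
  obtain N where N: "N \<in> null_sets M"
    and out: "\<forall>\<omega>\<in>space M - N. (\<forall>n\<ge>1. \<sigma> n \<omega> \<in> perms n) \<and> (\<exists>Q. is_limit \<omega> Q)"
  proof (rule AE_E3[OF good])
    fix N assume "\<And>\<omega>. \<omega> \<in> space M - N \<Longrightarrow> (\<forall>n\<ge>1. \<sigma> n \<omega> \<in> perms n) \<and> (\<exists>Q. is_limit \<omega> Q)" "N \<in> null_sets M"
    then show thesis by (intro that[of N] ballI)
  qed
  have outside: "\<forall>n\<ge>1. \<sigma> n \<omega> \<in> perms n" "\<exists>Q. is_limit \<omega> Q" if "\<omega> \<in> space M" "\<omega> \<notin> N" for \<omega>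
    using bspec[OF out, of \<omega>] that by simp_all
  define \<mu> where "\<mu> \<omega> = (if \<omega> \<in> space M - N then (SOME Q. is_limit \<omega> Q) else permuton_of [1])" for \<omega>
  have \<mu>_limit: "is_limit \<omega> (\<mu> \<omega>)" if "\<omega> \<in> space M" "\<omega> \<notin> N" for \<omega>
    using someI_ex[OF outside(2)[OF that]] that by (simp add: \<mu>_def)
  have one: "permuton_of [1] \<in> permutons"
    by (rule permuton_of_in_permutons[of _ 1]) (auto simp: perms_def)
  have \<mu>_permuton: "\<mu> \<omega> \<in> permutons" for \<omega>
  proof (cases "\<omega> \<in> space M - N")
    case True
    then show ?thesis using \<mu>_limit[of \<omega>] by (simp add: is_limit_def)
  next
    case False
    then show ?thesis using one by (simp only: \<mu>_def if_False)
  qed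
  show ?thesis
  proof (intro exI[of _ \<mu>] conjI)
    show "\<mu> \<in> M \<rightarrow>\<^sub>M borel_permutons"
    proof (rule measurable_borel_permutonsI)
      fix e
      have [measurable]: "(\<lambda>\<omega>. \<integral>z. poly_eval e z \<partial>permuton_of (\<sigma> (Suc n) \<omega>)) \<in> borel_measurable M" for n
        by (rule measurable_compose[OF \<sigma>m]) auto
      have [measurable]: "N \<in> sets M" using N by (rule null_setsD2)
      have "(\<lambda>\<omega>. if \<omega> \<in> N then (\<integral>z. poly_eval e z \<partial>permuton_of [1]) else lim (\<lambda>n. \<integral>z. poly_eval e z \<partial>permuton_of (\<sigma> (Suc n) \<omega>))) \<in> borel_measurable M"
        by measurable
      also have "?this \<longleftrightarrow> (\<lambda>\<omega>. \<integral>z. poly_eval e z \<partial>\<mu> \<omega>) \<in> borel_measurable M"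
      proof (rule measurable_cong)
        fix \<omega> assume \<omega>: "\<omega> \<in> space M"
        show "(if \<omega> \<in> N then (\<integral>z. poly_eval e z \<partial>permuton_of [1]) else lim (\<lambda>n. \<integral>z. poly_eval e z \<partial>permuton_of (\<sigma> (Suc n) \<omega>)))
          = (\<integral>z. poly_eval e z \<partial>\<mu> \<omega>)"
        proof (cases "\<omega> \<in> N")
          case True then show ?thesis by (simp add: \<mu>_def)
        next
          case False
          have "(\<lambda>n. \<integral>z. poly_eval e z \<partial>permuton_of (\<sigma> (Suc n) \<omega>)) \<longlonglongrightarrow> (\<integral>z. poly_eval e z \<partial>\<mu> \<omega>)"
            using \<mu>_limit[OF \<omega> False] unfolding is_limit_def by blast
          then show ?thesis using False by (simp add: limI)
        qed
      qed
      finally show "(\<lambda>\<omega>. \<integral>z. poly_eval e z \<partial>\<mu> \<omega>) \<in> borel_measurable M" .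
    qed (rule \<mu>_permuton)
    show "AE \<omega> in M. limitin weak_topology (\<lambda>n. permuton_of (\<sigma> n \<omega>)) (\<mu> \<omega>) sequentially"
    proof (rule AE_I'[OF N], rule subsetI, rule ccontr)
      fix \<omega> assume bad: "\<omega> \<in> {\<omega> \<in> space M. \<not> limitin weak_topology (\<lambda>n. permuton_of (\<sigma> n \<omega>)) (\<mu> \<omega>) sequentially}" and "\<omega> \<notin> N"
      then have \<omega>: "\<omega> \<in> space M" "\<omega> \<notin> N" by auto
      have "limitin weak_topology (\<lambda>n. permuton_of (\<sigma> n \<omega>)) (\<mu> \<omega>) sequentially"
      proof (rule weak_limitI[OF \<mu>_permuton])
        show "\<forall>\<^sub>F n in sequentially. permuton_of (\<sigma> n \<omega>) \<in> permutons"
          by (rule eventually_sequentiallyI[of 1]) (use outside(1)[OF \<omega>] permuton_of_in_permutons in blast)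
        show "(\<lambda>n. \<integral>z. poly_eval e z \<partial>permuton_of (\<sigma> n \<omega>)) \<longlonglongrightarrow> (\<integral>z. poly_eval e z \<partial>\<mu> \<omega>)" for e
          by (rule LIMSEQ_imp_Suc) (use \<mu>_limit[OF \<omega>] in \<open>simp add: is_limit_def\<close>)
      qed
      then show False using bad by simp
    qed
  qed
qed

end
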